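(* Consider $H=H(G,\chi,\eta,b,c,\beta)$. If $\beta=0$ or $c=b^{-1}$, then $H$ is generated over $\mathbb{K}[G]$ by $x$ and $z=c^{-1}y$, where $xz=zx$ and $z$ is $(c^{-1},1)$-primitive. Moreover, $H\simeq\mathbb{K}[x,z]\# G$ as algebras, where $\mathbb{K}[x,z]$ is the commutative polynomial ring in two variables and $g\in G$ acts on $x$ via $\chi^{-1}$ (i.e. $g\cdot x=\chi(g)^{-1}x$) and on $z$ via $\eta^{-1}$ (i.e. $g\cdot z=\eta(g)^{-1}z$).
   Context: $\mathbb{K}$ is an algebraically closed field of characteristic zero. For a group $G$, $Z(G)$ is its center and $\widehat{G}$ the group of homomorphisms $G\to\mathbb{K}^\times$. Let $(\chi,b),(\eta,c)\in\widehat{G}\times Z(G)$ with $\eta(b)=\chi(c)^{-1}$ and $\beta\in\mathbb{K}$. The Hopf algebra $H(G,\chi,\eta,b,c,\beta)$ is, as an algebra, the iterated Ore extension $\mathbb{K}[G][x;\tau_\chi][y;\tau_\eta,\delta]$ (convention: $R[x;\sigma,\delta]$ is free as a left $R$-module on the powers of $x$ with $xr=\sigma(r)x+\delta(r)$), where $\tau_\chi(g)=\chi(g)g$, $\tau_\eta(g)=\eta(g)g$ for $g\in G$, $\tau_\eta(x)=\eta(b)x$, and $\delta$ is the $\tau_\eta$-derivation with $\delta(g)=0$ for $g\in G$ and $\delta(x)=\beta(1-cb)$ (the data being such that this derivation exists). Thus $xg=\chi(g)gx$, $yg=\eta(g)gy$ and $yx=\eta(b)xy+\beta(1-cb)$.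 The elements of $G$ are group-like, $\Delta(x)=x\otimes1+b\otimes x$, $\Delta(y)=y\otimes 1+c\otimes y$, $\epsilon(x)=\epsilon(y)=0$. For group-like $g,h$, an element $u$ is $(g,h)$-primitive if $\Delta(u)=u\otimes g+h\otimes u$. For a group $G$ acting on an algebra $R$ by automorphisms, $R\#G$ is the skew group ring, with $g r=(g\cdot r)g$. *)

theory Defs
  imports
    "HOL-Computational_Algebra.Polynomial"
    "HOL-Algebra.QuotRing"
    "HOL-Algebra.Module"
    "HOL-Algebra.Generated_Rings"
begin

text \<open>
  The ground field is a type \<open>'k\<close>.  A (not necessarily commutative) algebra over it is
  represented by a record of type \<open>('k, 'a) module\<close>, i.e. a ring together with a scalar
  multiplication; the locale \<open>algebra\<close> of the library is not used because it is restricted to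
  commutative algebras.
\<close>

definition alg_hom :: "('k, 'a) module \<Rightarrow> ('k, 'b) module \<Rightarrow> ('a \<Rightarrow> 'b) set" where
  "alg_hom A B =
     {\<phi> \<in> ring_hom A B. \<forall>k. \<forall>a \<in> carrier A. \<phi> (k \<odot>\<^bsub>A\<^esub> a) = k \<odot>\<^bsub>B\<^esub> \<phi> a}"

definition alg_iso :: "('k, 'a) module \<Rightarrow> ('k, 'b) module \<Rightarrow> ('a \<Rightarrow> 'b) set" where
  "alg_iso A B = {\<phi> \<in> alg_hom A B. bij_betw \<phi> (carrier A) (carrier B)}"

definition ground_algebra :: "('k::field, 'k) module" where
  "ground_algebra =
     \<lparr>carrier = UNIV, mult = (*), one = 1, zero = 0, add = (+), smult = (*)\<rparr>"


subsection \<open>Characters and center\<close>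

definition char_group :: "('g, 'm) monoid_scheme \<Rightarrow> ('g \<Rightarrow> 'k::field) set" where
  "char_group G = hom G \<lparr>carrier = UNIV - {0}, mult = (*), one = 1\<rparr>"

definition group_center :: "('g, 'm) monoid_scheme \<Rightarrow> 'g set" where
  "group_center G = {z \<in> carrier G. \<forall>g \<in> carrier G. z \<otimes>\<^bsub>G\<^esub> g = g \<otimes>\<^bsub>G\<^esub> z}"


subsection \<open>Skew group rings and group algebras\<close>

text \<open>
  The elements of \<open>R # M\<close> are the finite sums of terms \<open>r m\<close> with coefficient \<open>r\<close> on the left,
  encoded by their coefficient function, so that \<open>(r a) (s b) = r (a \<cdot> s) (a b)\<close>.  The argument
  \<open>sc\<close> is the scalar multiplication of the algebra \<open>R\<close> (the type \<open>'r\<close>).  The definition is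
  meaningful for any monoid \<open>M\<close> acting by endomorphisms.
\<close>

definition skew_group_ring ::
  "('m, 'x) monoid_scheme \<Rightarrow> ('m \<Rightarrow> 'r \<Rightarrow> 'r) \<Rightarrow> ('k \<Rightarrow> 'r \<Rightarrow> 'r) \<Rightarrow> ('k, 'm \<Rightarrow> 'r::ring_1) module" where
  "skew_group_ring M act sc =
     \<lparr>carrier = {f. finite {m. f m \<noteq> 0} \<and> {m. f m \<noteq> 0} \<subseteq> carrier M},
      mult = (\<lambda>f h m.
        \<Sum>(a, b) \<in> {(a, b). f a \<noteq> 0 \<and> h b \<noteq> 0 \<and> a \<otimes>\<^bsub>M\<^esub> b = m}. f a * act a (h b)),
      one = (\<lambda>m. if m = \<one>\<^bsub>M\<^esub> then 1 else 0),
      zero = (\<lambda>m. 0),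
      add = (\<lambda>f h m. f m + h m),
      smult = (\<lambda>k f m. sc k (f m))\<rparr>"

definition single :: "'m \<Rightarrow> 'r::zero \<Rightarrow> 'm \<Rightarrow> 'r" where
  "single m r = (\<lambda>m'. if m' = m then r else 0)"

definition monoid_algebra :: "('m, 'x) monoid_scheme \<Rightarrow> ('k, 'm \<Rightarrow> 'k::field) module" where
  "monoid_algebra M = skew_group_ring M (\<lambda>_ r. r) (*)"


subsection \<open>Tensor products of algebras\<close>

text \<open>
  \<open>A \<otimes> B\<close> is the free vector space on \<open>A \<times> B\<close> modulo the bilinearity relations.  The free vector
  space carries the multiplication \<open>(a, b) (a', b') = (a a', b b')\<close>, i.e. it is the monoid algebra
  of the multiplicative monoid of \<open>A \<times> B\<close>; the linear span of the bilinearity relations is already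
  an ideal there, so that it makes no difference to divide by the ideal they generate.
\<close>

definition bilinear_relations :: "('k::field, 'a) module \<Rightarrow> ('k, 'b) module \<Rightarrow> ('a \<times> 'b \<Rightarrow> 'k) set" where
  "bilinear_relations A B =
     (let F = (monoid_algebra (A \<times>\<times> B) :: ('k, 'a \<times> 'b \<Rightarrow> 'k) module) in
       {single (a \<oplus>\<^bsub>A\<^esub> a', b) 1 \<ominus>\<^bsub>F\<^esub> (single (a, b) 1 \<oplus>\<^bsub>F\<^esub> single (a', b) 1) | a a' b.
          a \<in> carrier A \<and> a' \<in> carrier A \<and> b \<in> carrier B}
     \<union> {single (a, b \<oplus>\<^bsub>B\<^esub> b') 1 \<ominus>\<^bsub>F\<^esub> (single (a, b) 1 \<oplus>\<^bsub>F\<^esub> single (a, b') 1) | a b b'.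
          a \<in> carrier A \<and> b \<in> carrier B \<and> b' \<in> carrier B}
     \<union> {single (k \<odot>\<^bsub>A\<^esub> a, b) 1 \<ominus>\<^bsub>F\<^esub> single (a, b) k | k a b.
          a \<in> carrier A \<and> b \<in> carrier B}
     \<union> {single (a, k \<odot>\<^bsub>B\<^esub> b) 1 \<ominus>\<^bsub>F\<^esub> single (a, b) k | k a b.
          a \<in> carrier A \<and> b \<in> carrier B})"

definition tensor_ideal :: "('k::field, 'a) module \<Rightarrow> ('k, 'b) module \<Rightarrow> ('a \<times> 'b \<Rightarrow> 'k) set" where
  "tensor_ideal A B =
     genideal (monoid_algebra (A \<times>\<times> B) :: ('k, 'a \<times> 'b \<Rightarrow> 'k) module) (bilinear_relations A B)"

definition pure_tensor ::
  "('k::field, 'a) module \<Rightarrow> ('k, 'b) module \<Rightarrow> 'a \<Rightarrow> 'b \<Rightarrow> ('a \<times> 'b \<Rightarrow> 'k) set" where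
  "pure_tensor A B a b =
     tensor_ideal A B +>\<^bsub>(monoid_algebra (A \<times>\<times> B) :: ('k, 'a \<times> 'b \<Rightarrow> 'k) module)\<^esub> single (a, b) 1"

text \<open>Scalars act on the quotient through multiplication with \<open>(k \<one>) \<otimes> \<one>\<close>.\<close>

definition tensor_algebra ::
  "('k::field, 'a) module \<Rightarrow> ('k, 'b) module \<Rightarrow> ('k, ('a \<times> 'b \<Rightarrow> 'k) set) module" where
  "tensor_algebra A B =
     (let Q = (monoid_algebra (A \<times>\<times> B) :: ('k, 'a \<times> 'b \<Rightarrow> 'k) module) Quot tensor_ideal A B in
      ring.extend Q
        (module.fields (\<lambda>k t. pure_tensor A B (k \<odot>\<^bsub>A\<^esub> \<one>\<^bsub>A\<^esub>) \<one>\<^bsub>B\<^esub> \<otimes>\<^bsub>Q\<^esub> t)))"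


subsection \<open>Ore extensions\<close>

text \<open>
  \<open>R[x; \<sigma>, \<delta>]\<close> consists of the polynomials \<open>\<Sum>n. (p n) x\<^sup>n\<close> with coefficients on the left.  Left
  multiplication by \<open>x\<close> is forced by \<open>x r = \<sigma>(r) x + \<delta>(r)\<close>, and the product is
  \<open>p q = \<Sum>i. (p i) (x\<^sup>i q)\<close>.
\<close>

definition ore_lmult_var ::
  "('k, 'r) module \<Rightarrow> ('r \<Rightarrow> 'r) \<Rightarrow> ('r \<Rightarrow> 'r) \<Rightarrow> (nat \<Rightarrow> 'r) \<Rightarrow> nat \<Rightarrow> 'r" where
  "ore_lmult_var R \<sigma> \<delta> q =
     (\<lambda>n. (case n of 0 \<Rightarrow> \<zero>\<^bsub>R\<^esub> | Suc m \<Rightarrow> \<sigma> (q m)) \<oplus>\<^bsub>R\<^esub> \<delta> (q n))"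

definition ore_extension ::
  "('k, 'r) module \<Rightarrow> ('r \<Rightarrow> 'r) \<Rightarrow> ('r \<Rightarrow> 'r) \<Rightarrow> ('k, nat \<Rightarrow> 'r) module" where
  "ore_extension R \<sigma> \<delta> =
     \<lparr>carrier = {p. (\<forall>n. p n \<in> carrier R) \<and> finite {n. p n \<noteq> \<zero>\<^bsub>R\<^esub>}},
      mult = (\<lambda>p q n.
        \<Oplus>\<^bsub>R\<^esub>i \<in> {i. p i \<noteq> \<zero>\<^bsub>R\<^esub>}. p i \<otimes>\<^bsub>R\<^esub> ((ore_lmult_var R \<sigma> \<delta> ^^ i) q) n),
      one = (\<lambda>n. if n = 0 then \<one>\<^bsub>R\<^esub> else \<zero>\<^bsub>R\<^esub>),
      zero = (\<lambda>n. \<zero>\<^bsub>R\<^esub>),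
      add = (\<lambda>p q n. p n \<oplus>\<^bsub>R\<^esub> q n),
      smult = (\<lambda>k p n. k \<odot>\<^bsub>R\<^esub> p n)\<rparr>"

definition ore_const :: "('k, 'r) module \<Rightarrow> 'r \<Rightarrow> nat \<Rightarrow> 'r" where
  "ore_const R r = (\<lambda>n. if n = 0 then r else \<zero>\<^bsub>R\<^esub>)"

definition ore_var :: "('k, 'r) module \<Rightarrow> nat \<Rightarrow> 'r" where
  "ore_var R = (\<lambda>n. if n = 1 then \<one>\<^bsub>R\<^esub> else \<zero>\<^bsub>R\<^esub>)"

definition skew_derivation :: "('k, 'r) module \<Rightarrow> ('r \<Rightarrow> 'r) \<Rightarrow> ('r \<Rightarrow> 'r) \<Rightarrow> bool" where
  "skew_derivation R \<sigma> \<delta> \<longleftrightarrow>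
     \<delta> \<in> carrier R \<rightarrow> carrier R \<and>
     (\<forall>r \<in> carrier R. \<forall>s \<in> carrier R.
        \<delta> (r \<oplus>\<^bsub>R\<^esub> s) = \<delta> r \<oplus>\<^bsub>R\<^esub> \<delta> s \<and>
        \<delta> (r \<otimes>\<^bsub>R\<^esub> s) = \<sigma> r \<otimes>\<^bsub>R\<^esub> \<delta> s \<oplus>\<^bsub>R\<^esub> \<delta> r \<otimes>\<^bsub>R\<^esub> s) \<and>
     (\<forall>k. \<forall>r \<in> carrier R. \<delta> (k \<odot>\<^bsub>R\<^esub> r) = k \<odot>\<^bsub>R\<^esub> \<delta> r)"


subsection \<open>The Hopf algebra \<open>H(G, \<chi>, \<eta>, b, c, \<beta>)\<close>\<close>

definition tau_chi :: "('g \<Rightarrow> 'k::field) \<Rightarrow> ('g \<Rightarrow> 'k) \<Rightarrow> 'g \<Rightarrow> 'k" where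
  "tau_chi \<chi> f = (\<lambda>g. \<chi> g * f g)"

definition H_base ::
  "('g, 'm) monoid_scheme \<Rightarrow> ('g \<Rightarrow> 'k::field) \<Rightarrow> ('k, nat \<Rightarrow> 'g \<Rightarrow> 'k) module" where
  "H_base G \<chi> = ore_extension (monoid_algebra G) (tau_chi \<chi>) (\<lambda>_. \<zero>\<^bsub>monoid_algebra G\<^esub>)"

text \<open>The algebra endomorphism of \<open>K[G][x; \<tau>\<^sub>\<chi>]\<close> with \<open>g \<mapsto> \<eta>(g) g\<close> and \<open>x \<mapsto> \<eta>(b) x\<close>.\<close>

definition tau_eta :: "('g \<Rightarrow> 'k::field) \<Rightarrow> 'g \<Rightarrow> (nat \<Rightarrow> 'g \<Rightarrow> 'k) \<Rightarrow> nat \<Rightarrow> 'g \<Rightarrow> 'k" where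
  "tau_eta \<eta> b p = (\<lambda>n g. \<eta> b ^ n * (\<eta> g * p n g))"

definition base_emb ::
  "('g, 'm) monoid_scheme \<Rightarrow> ('g \<Rightarrow> 'k::field) \<Rightarrow> nat \<Rightarrow> 'g \<Rightarrow> 'k" where
  "base_emb G = ore_const (monoid_algebra G)"

definition base_x :: "('g, 'm) monoid_scheme \<Rightarrow> nat \<Rightarrow> 'g \<Rightarrow> 'k::field" where
  "base_x G = ore_var (monoid_algebra G)"

text \<open>
  The derivation \<open>\<delta>\<close> is determined on the carrier by these conditions, but exists only for suitable
  data; hence it is an explicit argument in what follows.
\<close>

definition H_derivation ::
  "('g, 'm) monoid_scheme \<Rightarrow> ('g \<Rightarrow> 'k::field) \<Rightarrow> ('g \<Rightarrow> 'k) \<Rightarrow> 'g \<Rightarrow> 'g \<Rightarrow> 'k \<Rightarrow>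
     ((nat \<Rightarrow> 'g \<Rightarrow> 'k) \<Rightarrow> (nat \<Rightarrow> 'g \<Rightarrow> 'k)) \<Rightarrow> bool" where
  "H_derivation G \<chi> \<eta> b c \<beta> \<delta> \<longleftrightarrow>
     skew_derivation (H_base G \<chi>) (tau_eta \<eta> b) \<delta> \<and>
     (\<forall>g \<in> carrier G. \<delta> (base_emb G (single g 1)) = \<zero>\<^bsub>H_base G \<chi>\<^esub>) \<and>
     \<delta> (base_x G) =
       \<beta> \<odot>\<^bsub>H_base G \<chi>\<^esub>
         (\<one>\<^bsub>H_base G \<chi>\<^esub> \<ominus>\<^bsub>H_base G \<chi>\<^esub> base_emb G (single (c \<otimes>\<^bsub>G\<^esub> b) 1))"

text \<open>The parameters \<open>c\<close> and \<open>\<beta>\<close> enter the algebra structure only through \<open>\<delta>\<close>.\<close>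

definition H_alg ::
  "('g, 'm) monoid_scheme \<Rightarrow> ('g \<Rightarrow> 'k::field) \<Rightarrow> ('g \<Rightarrow> 'k) \<Rightarrow> 'g \<Rightarrow>
     ((nat \<Rightarrow> 'g \<Rightarrow> 'k) \<Rightarrow> (nat \<Rightarrow> 'g \<Rightarrow> 'k)) \<Rightarrow> ('k, nat \<Rightarrow> nat \<Rightarrow> 'g \<Rightarrow> 'k) module" where
  "H_alg G \<chi> \<eta> b \<delta> = ore_extension (H_base G \<chi>) (tau_eta \<eta> b) \<delta>"

definition H_emb ::
  "('g, 'm) monoid_scheme \<Rightarrow> ('g \<Rightarrow> 'k::field) \<Rightarrow> ('g \<Rightarrow> 'k) \<Rightarrow> nat \<Rightarrow> nat \<Rightarrow> 'g \<Rightarrow> 'k" where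
  "H_emb G \<chi> f = ore_const (H_base G \<chi>) (base_emb G f)"

definition H_grp ::
  "('g, 'm) monoid_scheme \<Rightarrow> ('g \<Rightarrow> 'k::field) \<Rightarrow> 'g \<Rightarrow> nat \<Rightarrow> nat \<Rightarrow> 'g \<Rightarrow> 'k" where
  "H_grp G \<chi> g = H_emb G \<chi> (single g 1)"

definition H_x :: "('g, 'm) monoid_scheme \<Rightarrow> ('g \<Rightarrow> 'k::field) \<Rightarrow> nat \<Rightarrow> nat \<Rightarrow> 'g \<Rightarrow> 'k" where
  "H_x G \<chi> = ore_const (H_base G \<chi>) (base_x G)"

definition H_y :: "('g, 'm) monoid_scheme \<Rightarrow> ('g \<Rightarrow> 'k::field) \<Rightarrow> nat \<Rightarrow> nat \<Rightarrow> 'g \<Rightarrow> 'k" where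
  "H_y G \<chi> = ore_var (H_base G \<chi>)"

definition group_like ::
  "('k::field, 'a) module \<Rightarrow> ('a \<Rightarrow> ('a \<times> 'a \<Rightarrow> 'k) set) \<Rightarrow> ('a \<Rightarrow> 'k) \<Rightarrow> 'a \<Rightarrow> bool" where
  "group_like A \<Delta> \<epsilon> g \<longleftrightarrow> g \<in> carrier A \<and> \<Delta> g = pure_tensor A A g g \<and> \<epsilon> g = 1"

text \<open>\<open>u\<close> is \<open>(g, h)\<close>-primitive for the group-like elements \<open>g\<close> and \<open>h\<close>.\<close>

definition skew_primitive ::
  "('k::field, 'a) module \<Rightarrow> ('a \<Rightarrow> ('a \<times> 'a \<Rightarrow> 'k) set) \<Rightarrow> ('a \<Rightarrow> 'k) \<Rightarrow> 'a \<Rightarrow> 'a \<Rightarrow> 'a \<Rightarrow> bool" where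
  "skew_primitive A \<Delta> \<epsilon> g h u \<longleftrightarrow>
     group_like A \<Delta> \<epsilon> g \<and> group_like A \<Delta> \<epsilon> h \<and> u \<in> carrier A \<and>
     \<Delta> u = pure_tensor A A u g \<oplus>\<^bsub>tensor_algebra A A\<^esub> pure_tensor A A h u"

text \<open>
  The comultiplication and the counit are algebra homomorphisms, hence determined on the carrier
  by their values on the generators.  Coassociativity, counitality and the antipode follow from
  these conditions and need not be required.
\<close>

definition H_coalgebra ::
  "('g, 'm) monoid_scheme \<Rightarrow> ('g \<Rightarrow> 'k::field) \<Rightarrow> ('g \<Rightarrow> 'k) \<Rightarrow> 'g \<Rightarrow> 'g \<Rightarrow>
     ((nat \<Rightarrow> 'g \<Rightarrow> 'k) \<Rightarrow> (nat \<Rightarrow> 'g \<Rightarrow> 'k)) \<Rightarrow>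
     ((nat \<Rightarrow> nat \<Rightarrow> 'g \<Rightarrow> 'k) \<Rightarrow> ((nat \<Rightarrow> nat \<Rightarrow> 'g \<Rightarrow> 'k) \<times> (nat \<Rightarrow> nat \<Rightarrow> 'g \<Rightarrow> 'k) \<Rightarrow> 'k) set) \<Rightarrow>
     ((nat \<Rightarrow> nat \<Rightarrow> 'g \<Rightarrow> 'k) \<Rightarrow> 'k) \<Rightarrow> bool" where
  "H_coalgebra G \<chi> \<eta> b c \<delta> \<Delta> \<epsilon> \<longleftrightarrow>
     (let H = H_alg G \<chi> \<eta> b \<delta>; T = tensor_algebra H H; x = H_x G \<chi>; y = H_y G \<chi> in
       \<Delta> \<in> alg_hom H T \<and> \<epsilon> \<in> alg_hom H ground_algebra \<and>
       (\<forall>g \<in> carrier G. group_like H \<Delta> \<epsilon> (H_grp G \<chi> g)) \<and>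
       \<Delta> x = pure_tensor H H x \<one>\<^bsub>H\<^esub> \<oplus>\<^bsub>T\<^esub> pure_tensor H H (H_grp G \<chi> b) x \<and>
       \<Delta> y = pure_tensor H H y \<one>\<^bsub>H\<^esub> \<oplus>\<^bsub>T\<^esub> pure_tensor H H (H_grp G \<chi> c) y \<and>
       \<epsilon> x = 0 \<and> \<epsilon> y = 0)"

definition H_z ::
  "('g, 'm) monoid_scheme \<Rightarrow> ('g \<Rightarrow> 'k::field) \<Rightarrow> ('g \<Rightarrow> 'k) \<Rightarrow> 'g \<Rightarrow> 'g \<Rightarrow>
     ((nat \<Rightarrow> 'g \<Rightarrow> 'k) \<Rightarrow> (nat \<Rightarrow> 'g \<Rightarrow> 'k)) \<Rightarrow> nat \<Rightarrow> nat \<Rightarrow> 'g \<Rightarrow> 'k" where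
  "H_z G \<chi> \<eta> b c \<delta> = H_grp G \<chi> (inv\<^bsub>G\<^esub> c) \<otimes>\<^bsub>H_alg G \<chi> \<eta> b \<delta>\<^esub> H_y G \<chi>"


subsection \<open>The skew group ring \<open>K[x, z] # G\<close>\<close>

text \<open>
  \<open>K[x, z]\<close> is \<open>K[x][z]\<close>: the outer polynomial variable is \<open>z\<close>, the inner one is \<open>x\<close>.  The element
  \<open>g\<close> acts by the algebra automorphism \<open>p(x, z) \<mapsto> p(\<chi>(g)\<^sup>-\<^sup>1 x, \<eta>(g)\<^sup>-\<^sup>1 z)\<close>.
\<close>

definition poly_x :: "'k::field poly poly" where
  "poly_x = [:[:0, 1:]:]"

definition poly_z :: "'k::field poly poly" where
  "poly_z = [:0, 1:]"

definition poly_act ::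
  "('g \<Rightarrow> 'k::field) \<Rightarrow> ('g \<Rightarrow> 'k) \<Rightarrow> 'g \<Rightarrow> 'k poly poly \<Rightarrow> 'k poly poly" where
  "poly_act \<chi> \<eta> g p =
     pcompose (map_poly (\<lambda>q. pcompose q [:0, inverse (\<chi> g):]) p) [:0, [:inverse (\<eta> g):]:]"

definition poly_skew_group_ring ::
  "('g, 'm) monoid_scheme \<Rightarrow> ('g \<Rightarrow> 'k::field) \<Rightarrow> ('g \<Rightarrow> 'k) \<Rightarrow> ('k, 'g \<Rightarrow> 'k poly poly) module" where
  "poly_skew_group_ring G \<chi> \<eta> =
     skew_group_ring G (poly_act \<chi> \<eta>) (\<lambda>k. Polynomial.smult [:k:])"

end

theory Submission
  imports Defs "HOL-Library.Nat_Bijection"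
begin

text \<open>
  In both cases of the hypothesis \<open>\<delta>(x) = \<beta>(1 - cb)\<close> vanishes, and a twisted derivation that kills
  the group elements and \<open>x\<close> is zero (\<open>derivation_trivial\<close>).  So \<open>H\<close> has the basis \<open>g x\<^sup>m y\<^sup>n\<close>, and in a
  product of basis elements \<open>x\<close>, \<open>y\<close> and the group elements move past each other at the cost of
  nonzero scalars only.

  In particular \<open>y x = \<eta>(b) x y\<close> with \<open>\<eta>(b) = \<chi>(c)\<inverse>\<close>.  The factor is undone by the one that \<open>c\<inverse>\<close>
  picks up when it is moved past \<open>x\<close>; hence \<open>z = c\<inverse> y\<close> commutes with \<open>x\<close>, and
  \<open>g x = \<chi>(g)\<inverse> x g\<close>, \<open>g z = \<eta>(g)\<inverse> z g\<close> are the relations of \<open>K[x, z] # G\<close>.  Rewriting a basis element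
  of \<open>H\<close> with these rules gives, for \<open>t = n(n+1)/2\<close>,

    \<open>g x\<^sup>m y\<^sup>n = (\<eta>(c)\<^sup>t \<chi>(g)\<^sup>m \<eta>(g)\<^sup>n)\<inverse> x\<^sup>m z\<^sup>n (g c\<^sup>n)\<close>,

  a bijection between bases up to nonzero scalars.  This formula is taken as the definition of the
  isomorphism \<open>phi\<close>: it turns the coefficient function of an element of \<open>H\<close> into that of its image,
  which makes bijectivity elementary (\<open>phi_bij\<close>).  Multiplicativity (\<open>phi_mult\<close>) is a comparison of
  the two convolution formulas \<open>H_mult_coeff\<close> and \<open>S_mult_eq\<close>.  A shift of the summation index by
  \<open>c\<^sup>n\<close>, where the centrality of \<open>c\<close> enters, reduces it to an identity of scalars (\<open>weight_add\<close>), where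
  \<open>\<eta>(b) = \<chi>(c)\<inverse>\<close> enters.

  Only the skew group ring is checked directly to be a ring; \<open>H\<close> inherits the ring axioms, the
  commutation of \<open>x\<close> and \<open>z\<close> and the generation statement along \<open>phi\<close>.  The coproduct of \<open>z\<close> is
  \<open>\<Delta>(c\<inverse>) \<Delta>(y) = (c\<inverse> \<otimes> c\<inverse>) (y \<otimes> 1 + c \<otimes> y) = z \<otimes> c\<inverse> + 1 \<otimes> z\<close>.
\<close>

section \<open>Induction, transport of structure and bivariate coefficients\<close>

lemma finite_support_induct [consumes 1, case_names zero step]:
  assumes "finite {x. f x \<noteq> z}" and zero: "P (\<lambda>_. z)"
    and step: "\<And>f x. finite {x. f x \<noteq> z} \<Longrightarrow> P (f(x := z)) \<Longrightarrow> P f"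
  shows "P f"
  using assms(1)
proof (induction "card {x. f x \<noteq> z}" arbitrary: f)
  case 0
  then have "f = (\<lambda>_. z)" by auto
  then show ?case using zero by simp
next
  case (Suc n)
  then obtain x where x: "f x \<noteq> z" by (metis (mono_tags, lifting) card_eq_0_iff empty_Collect_eq nat.distinct(1))
  have "{y. (f(x := z)) y \<noteq> z} = {y. f y \<noteq> z} - {x}" by auto
  with Suc x have "P (f(x := z))" by (intro Suc.hyps(1)) auto
  then show ?case by (rule step[OF Suc.prems])
qed

lemma ring_if_isomorphic:
  assumes S: "ring S" and bij: "bij_betw f (carrier R) (carrier S)"
    and closed: "\<And>u v. u \<in> carrier R \<Longrightarrow> v \<in> carrier R \<Longrightarrow> u \<oplus>\<^bsub>R\<^esub> v \<in> carrier R"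
      "\<And>u v. u \<in> carrier R \<Longrightarrow> v \<in> carrier R \<Longrightarrow> u \<otimes>\<^bsub>R\<^esub> v \<in> carrier R"
      "\<zero>\<^bsub>R\<^esub> \<in> carrier R" "\<one>\<^bsub>R\<^esub> \<in> carrier R"
    and hom: "\<And>u v. u \<in> carrier R \<Longrightarrow> v \<in> carrier R \<Longrightarrow> f (u \<oplus>\<^bsub>R\<^esub> v) = f u \<oplus>\<^bsub>S\<^esub> f v"
      "\<And>u v. u \<in> carrier R \<Longrightarrow> v \<in> carrier R \<Longrightarrow> f (u \<otimes>\<^bsub>R\<^esub> v) = f u \<otimes>\<^bsub>S\<^esub> f v"
      "f \<zero>\<^bsub>R\<^esub> = \<zero>\<^bsub>S\<^esub>" "f \<one>\<^bsub>R\<^esub> = \<one>\<^bsub>S\<^esub>"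
  shows "ring R"
proof -
  let ?g = "inv_into (carrier R) f"
  have g: "?g y \<in> carrier R" "f (?g y) = y" if "y \<in> carrier S" for y
    using that bij by (auto simp: bij_betw_def inv_into_into f_inv_into_f)
  have gf: "?g (f u) = u" if "u \<in> carrier R" for u
    using that bij by (simp add: bij_betw_def inv_into_f_f)
  have "?g \<in> ring_iso S R"
  proof -
    have "?g \<in> ring_hom S R"
    proof (rule ring_hom_memI)
      fix s t assume st: "s \<in> carrier S" "t \<in> carrier S"
      show "?g s \<in> carrier R" using g st by simp
      show "?g (s \<otimes>\<^bsub>S\<^esub> t) = ?g s \<otimes>\<^bsub>R\<^esub> ?g t"
        using gf[of "?g s \<otimes>\<^bsub>R\<^esub> ?g t"] by (simp add: g st hom closed)
      show "?g (s \<oplus>\<^bsub>S\<^esub> t) = ?g s \<oplus>\<^bsub>R\<^esub> ?g t"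
        using gf[of "?g s \<oplus>\<^bsub>R\<^esub> ?g t"] by (simp add: g st hom closed)
    qed (use gf[of "\<one>\<^bsub>R\<^esub>"] in \<open>simp add: hom closed\<close>)
    then show ?thesis using bij by (simp add: ring_iso_def bij_betw_inv_into)
  qed
  then have "ring (R\<lparr>zero := ?g \<zero>\<^bsub>S\<^esub>\<rparr>)" by (rule ring.ring_iso_imp_img_ring[OF S])
  moreover have "?g \<zero>\<^bsub>S\<^esub> = \<zero>\<^bsub>R\<^esub>" using gf[of "\<zero>\<^bsub>R\<^esub>"] by (simp add: hom closed)
  ultimately show ?thesis by simp
qed

lemma coeff_Abs_poly_finite:
  assumes "finite {n. f n \<noteq> 0}"
  shows "Polynomial.coeff (Abs_poly f) = f"
  by (rule Abs_poly_inverse) (use assms in \<open>simp add: eventually_cofinite\<close>)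

lemma poly_poly_eqI:
  assumes "\<And>n m. Polynomial.coeff (Polynomial.coeff p n) m = Polynomial.coeff (Polynomial.coeff q n) m"
  shows "p = q"
  using assms by (intro poly_eqI)

lemma triangle_add: "triangle (n + n') = triangle n + triangle n' + n * n'"
  by (induction n') (auto simp: algebra_simps)

abbreviation cf :: "'k::zero poly poly \<Rightarrow> nat \<Rightarrow> nat \<Rightarrow> 'k" where
  "cf p n m \<equiv> Polynomial.coeff (Polynomial.coeff p n) m"

lemma cf_mult:
  fixes p q :: "'k::comm_ring_1 poly poly"
  shows "cf (p * q) n m = (\<Sum>j\<le>n. \<Sum>i\<le>m. cf p j i * cf q (n - j) (m - i))"
  by (simp add: coeff_mult coeff_sum)

section \<open>Skew group rings\<close>

text \<open>
  Besides \<open>K[x, z] # G\<close>, this covers \<open>K[G]\<close> and the monoid algebra of which a tensor product of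
  rings is a quotient; in the latter case \<open>M\<close> is not a group.
\<close>

locale skew_action = monoid M for M :: "('m, 'x) monoid_scheme" (structure) +
  fixes act :: "'m \<Rightarrow> 'r::ring_1 \<Rightarrow> 'r"
  assumes act_add: "a \<in> carrier M \<Longrightarrow> act a (r + s) = act a r + act a s"
    and act_mult: "a \<in> carrier M \<Longrightarrow> act a (r * s) = act a r * act a s"
    and act_unit: "a \<in> carrier M \<Longrightarrow> act a 1 = 1"
    and act_one: "act \<one> r = r"
    and act_act: "a \<in> carrier M \<Longrightarrow> a' \<in> carrier M \<Longrightarrow> act (a \<otimes> a') r = act a (act a' r)"
begin

abbreviation supp :: "('m \<Rightarrow> 'r) \<Rightarrow> 'm set" where "supp f \<equiv> {m. f m \<noteq> 0}"

lemma act_zero: "a \<in> carrier M \<Longrightarrow> act a 0 = 0"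
  using act_add[of a 0 0] by simp

lemma act_sum: "a \<in> carrier M \<Longrightarrow> act a (\<Sum>i\<in>I. f i) = (\<Sum>i\<in>I. act a (f i))"
  by (induction I rule: infinite_finite_induct) (auto simp: act_zero act_add)

context
  fixes sc :: "'k \<Rightarrow> 'r \<Rightarrow> 'r"
begin

abbreviation S :: "('k, 'm \<Rightarrow> 'r) module" where "S \<equiv> skew_group_ring M act sc"

lemma carrier_iff: "f \<in> carrier S \<longleftrightarrow> finite (supp f) \<and> supp f \<subseteq> carrier M"
  by (simp add: skew_group_ring_def)

lemma carrier_value_out: "f \<in> carrier S \<Longrightarrow> m \<notin> carrier M \<Longrightarrow> f m = 0"
  by (auto simp: carrier_iff)

lemma ops:
  "f \<oplus>\<^bsub>S\<^esub> h = (\<lambda>m. f m + h m)" "\<zero>\<^bsub>S\<^esub> = (\<lambda>_. 0)" "k \<odot>\<^bsub>S\<^esub> f = (\<lambda>m. sc k (f m))"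
  "\<one>\<^bsub>S\<^esub> = single \<one> 1"
  by (auto simp: skew_group_ring_def single_def)

text \<open>
  In the defining sum the index set depends on both factors.  Summing over fixed finite sets that
  contain the supports instead makes the product visibly bilinear.
\<close>

lemma mult_eq:
  assumes "finite A" "supp f \<subseteq> A" "A \<subseteq> carrier M" "finite B" "supp h \<subseteq> B"
  shows "(f \<otimes>\<^bsub>S\<^esub> h) m = (\<Sum>a\<in>A. \<Sum>b\<in>B. if a \<otimes> b = m then f a * act a (h b) else 0)"
proof -
  have "(\<Sum>a\<in>A. \<Sum>b\<in>B. if a \<otimes> b = m then f a * act a (h b) else 0)
      = (\<Sum>(a, b)\<in>A \<times> B. if a \<otimes> b = m then f a * act a (h b) else 0)"
    by (rule sum.cartesian_product)
  also have "\<dots> = (\<Sum>(a, b)\<in>{(a, b). f a \<noteq> 0 \<and> h b \<noteq> 0 \<and> a \<otimes> b = m}. f a * act a (h b))"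
    by (rule sum.mono_neutral_cong_right) (use assms in \<open>auto simp: act_zero split: if_splits\<close>)
  finally show ?thesis by (simp add: skew_group_ring_def)
qed

lemma mult_closed:
  assumes "f \<in> carrier S" "h \<in> carrier S"
  shows "f \<otimes>\<^bsub>S\<^esub> h \<in> carrier S"
proof -
  let ?P = "(\<lambda>(a, b). a \<otimes> b) ` (supp f \<times> supp h)"
  have "(f \<otimes>\<^bsub>S\<^esub> h) m = 0" if "m \<notin> ?P" for m
    using assms that unfolding carrier_iff
    by (subst mult_eq[of "supp f" f "supp h" h]) (auto intro!: sum.neutral)
  then have "supp (f \<otimes>\<^bsub>S\<^esub> h) \<subseteq> ?P" by blast
  moreover have "finite ?P" "?P \<subseteq> carrier M" using assms by (auto simp: carrier_iff)
  ultimately show ?thesis unfolding carrier_iff using finite_subset by blast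
qed

lemma add_closed:
  assumes "f \<in> carrier S" "h \<in> carrier S"
  shows "f \<oplus>\<^bsub>S\<^esub> h \<in> carrier S"
proof -
  have "supp (\<lambda>m. f m + h m) \<subseteq> supp f \<union> supp h" by auto
  then show ?thesis using assms unfolding carrier_iff ops
    by (meson finite_UnI finite_subset order_trans Un_least)
qed

lemma single_closed: "a \<in> carrier M \<Longrightarrow> single a r \<in> carrier S"
  by (auto simp: carrier_iff single_def)

lemma single_mult:
  assumes "a \<in> carrier M"
  shows "single a r \<otimes>\<^bsub>S\<^esub> single b s = single (a \<otimes> b) (r * act a s)"
  using assms by (intro ext, subst mult_eq[of "{a}" _ "{b}"]) (auto simp: single_def)

text \<open>
  Both bracketings are expanded to the sum of \<open>f a \<cdot> act a (h b) \<cdot> act (a b) (k c)\<close> over all triples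
  with \<open>a b c = m\<close>; the sum over the intermediate product \<open>a b\<close> or \<open>b c\<close> collapses to one term.
\<close>

lemma mult_assoc:
  assumes f: "f \<in> carrier S" and h: "h \<in> carrier S" and k: "k \<in> carrier S"
  shows "(f \<otimes>\<^bsub>S\<^esub> h) \<otimes>\<^bsub>S\<^esub> k = f \<otimes>\<^bsub>S\<^esub> (h \<otimes>\<^bsub>S\<^esub> k)"
proof
  fix m
  define A B C where "A = supp f" and "B = supp h" and "C = supp k"
  note fin = f[unfolded carrier_iff, folded A_def] h[unfolded carrier_iff, folded B_def]
    k[unfolded carrier_iff, folded C_def]
  have fh: "(f \<otimes>\<^bsub>S\<^esub> h) d = (\<Sum>a\<in>A. \<Sum>b\<in>B. if a \<otimes> b = d then f a * act a (h b) else 0)" for d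
    using fin by (intro mult_eq) (auto simp: A_def B_def)
  have hk: "(h \<otimes>\<^bsub>S\<^esub> k) d = (\<Sum>b\<in>B. \<Sum>c\<in>C. if b \<otimes> c = d then h b * act b (k c) else 0)" for d
    using fin by (intro mult_eq) (auto simp: C_def B_def)
  \<comment> \<open>\<open>D\<close> and \<open>E\<close> contain all the products, so that each inner sum meets its one nonzero term, and
    the supports, as \<open>mult_eq\<close> requires.\<close>
  define D where "D = (\<lambda>(a, b). a \<otimes> b) ` (A \<times> B) \<union> supp (f \<otimes>\<^bsub>S\<^esub> h)"
  define E where "E = (\<lambda>(a, b). a \<otimes> b) ` (B \<times> C) \<union> supp (h \<otimes>\<^bsub>S\<^esub> k)"
  have D: "finite D" "D \<subseteq> carrier M" and E: "finite E" "E \<subseteq> carrier M"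
    using fin mult_closed[OF f h] mult_closed[OF h k] by (auto simp: D_def E_def carrier_iff)
  let ?T = "\<Sum>a\<in>A. \<Sum>b\<in>B. \<Sum>c\<in>C. if a \<otimes> b \<otimes> c = m then f a * act a (h b) * act (a \<otimes> b) (k c) else 0"
  have "((f \<otimes>\<^bsub>S\<^esub> h) \<otimes>\<^bsub>S\<^esub> k) m
      = (\<Sum>d\<in>D. \<Sum>c\<in>C. if d \<otimes> c = m then (f \<otimes>\<^bsub>S\<^esub> h) d * act d (k c) else 0)"
    using fin D by (intro mult_eq) (auto simp: C_def D_def)
  also have "\<dots> = (\<Sum>d\<in>D. \<Sum>c\<in>C. \<Sum>a\<in>A. \<Sum>b\<in>B.
      if d = a \<otimes> b then if d \<otimes> c = m then f a * act a (h b) * act d (k c) else 0 else 0)"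
    unfolding fh by (auto intro!: sum.cong sum.neutral simp: sum_distrib_right)
  also have "\<dots> = (\<Sum>a\<in>A. \<Sum>b\<in>B. \<Sum>c\<in>C. \<Sum>d\<in>D.
      if d = a \<otimes> b then if d \<otimes> c = m then f a * act a (h b) * act d (k c) else 0 else 0)"
    by (simp only: sum.swap[of _ C]) (simp only: sum.swap[of _ D])
  also have "\<dots> = ?T"
    by (intro sum.cong refl) (use D in \<open>auto simp: sum.delta D_def\<close>)
  finally have l: "((f \<otimes>\<^bsub>S\<^esub> h) \<otimes>\<^bsub>S\<^esub> k) m = ?T" .
  have "(f \<otimes>\<^bsub>S\<^esub> (h \<otimes>\<^bsub>S\<^esub> k)) m
      = (\<Sum>a\<in>A. \<Sum>e\<in>E. if a \<otimes> e = m then f a * act a ((h \<otimes>\<^bsub>S\<^esub> k) e) else 0)"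
    using fin E by (intro mult_eq) (auto simp: A_def E_def)
  also have "\<dots> = (\<Sum>a\<in>A. \<Sum>e\<in>E. \<Sum>b\<in>B. \<Sum>c\<in>C.
      if e = b \<otimes> c then if a \<otimes> e = m then f a * act a (h b * act b (k c)) else 0 else 0)"
  proof (intro sum.cong refl)
    fix a e assume "a \<in> A"
    then have "a \<in> carrier M" using fin by auto
    then have "act a ((h \<otimes>\<^bsub>S\<^esub> k) e)
        = (\<Sum>b\<in>B. \<Sum>c\<in>C. if e = b \<otimes> c then act a (h b * act b (k c)) else 0)"
      unfolding hk by (auto simp: act_sum act_zero intro!: sum.cong)
    then show "(if a \<otimes> e = m then f a * act a ((h \<otimes>\<^bsub>S\<^esub> k) e) else 0)
        = (\<Sum>b\<in>B. \<Sum>c\<in>C.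
            if e = b \<otimes> c then if a \<otimes> e = m then f a * act a (h b * act b (k c)) else 0 else 0)"
      by (auto simp: sum_distrib_left intro!: sum.cong sum.neutral)
  qed
  also have "\<dots> = (\<Sum>a\<in>A. \<Sum>b\<in>B. \<Sum>c\<in>C. \<Sum>e\<in>E.
      if e = b \<otimes> c then if a \<otimes> e = m then f a * act a (h b * act b (k c)) else 0 else 0)"
    by (simp only: sum.swap[of _ E])
  also have "\<dots> = ?T"
    by (intro sum.cong refl)
       (use E fin in \<open>auto simp: sum.delta E_def act_mult act_act m_assoc mult.assoc subset_iff\<close>)
  finally show "((f \<otimes>\<^bsub>S\<^esub> h) \<otimes>\<^bsub>S\<^esub> k) m = (f \<otimes>\<^bsub>S\<^esub> (h \<otimes>\<^bsub>S\<^esub> k)) m" using l by simp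
qed

lemma one_mult:
  assumes f: "f \<in> carrier S"
  shows "\<one>\<^bsub>S\<^esub> \<otimes>\<^bsub>S\<^esub> f = f" and "f \<otimes>\<^bsub>S\<^esub> \<one>\<^bsub>S\<^esub> = f"
proof -
  note f' = f[unfolded carrier_iff]
  show "\<one>\<^bsub>S\<^esub> \<otimes>\<^bsub>S\<^esub> f = f"
  proof
    fix m
    have "(\<one>\<^bsub>S\<^esub> \<otimes>\<^bsub>S\<^esub> f) m
        = (\<Sum>a\<in>{\<one>}. \<Sum>b\<in>supp f. if a \<otimes> b = m then \<one>\<^bsub>S\<^esub> a * act a (f b) else 0)"
      using f' by (intro mult_eq) (auto simp: ops single_def)
    also have "\<dots> = (\<Sum>b\<in>supp f. if b = m then f b else 0)"
      by (simp, intro sum.cong refl) (use f' in \<open>auto simp: ops single_def act_one\<close>)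
    also have "\<dots> = f m" using f' by (simp add: sum.delta)
    finally show "(\<one>\<^bsub>S\<^esub> \<otimes>\<^bsub>S\<^esub> f) m = f m" .
  qed
  show "f \<otimes>\<^bsub>S\<^esub> \<one>\<^bsub>S\<^esub> = f"
  proof
    fix m
    have "(f \<otimes>\<^bsub>S\<^esub> \<one>\<^bsub>S\<^esub>) m
        = (\<Sum>a\<in>supp f. \<Sum>b\<in>{\<one>}. if a \<otimes> b = m then f a * act a (\<one>\<^bsub>S\<^esub> b) else 0)"
      using f' by (intro mult_eq) (auto simp: ops single_def)
    also have "\<dots> = (\<Sum>b\<in>supp f. if b = m then f b else 0)"
      by (simp, intro sum.cong refl) (use f' in \<open>auto simp: ops single_def act_unit\<close>)
    also have "\<dots> = f m" using f' by (simp add: sum.delta)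
    finally show "(f \<otimes>\<^bsub>S\<^esub> \<one>\<^bsub>S\<^esub>) m = f m" .
  qed
qed

lemma distrib:
  assumes "f \<in> carrier S" "h \<in> carrier S" "k \<in> carrier S"
  shows "(f \<oplus>\<^bsub>S\<^esub> h) \<otimes>\<^bsub>S\<^esub> k = f \<otimes>\<^bsub>S\<^esub> k \<oplus>\<^bsub>S\<^esub> h \<otimes>\<^bsub>S\<^esub> k"
    and "k \<otimes>\<^bsub>S\<^esub> (f \<oplus>\<^bsub>S\<^esub> h) = k \<otimes>\<^bsub>S\<^esub> f \<oplus>\<^bsub>S\<^esub> k \<otimes>\<^bsub>S\<^esub> h"
proof -
  note car = assms[unfolded carrier_iff]
  define A where "A = supp f \<union> supp h"
  define C where "C = supp k"
  have A: "finite A" "A \<subseteq> carrier M" "supp f \<subseteq> A" "supp h \<subseteq> A" "supp (\<lambda>m. f m + h m) \<subseteq> A"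
    and C: "finite C" "C \<subseteq> carrier M" "supp k \<subseteq> C"
    using car by (auto simp: A_def C_def)
  have l: "(u \<otimes>\<^bsub>S\<^esub> k) m = (\<Sum>a\<in>A. \<Sum>b\<in>C. if a \<otimes> b = m then u a * act a (k b) else 0)"
    and r: "(k \<otimes>\<^bsub>S\<^esub> u) m = (\<Sum>a\<in>C. \<Sum>b\<in>A. if a \<otimes> b = m then k a * act a (u b) else 0)"
    if "supp u \<subseteq> A" for u m
    using A C that by (auto intro!: mult_eq)
  show "(f \<oplus>\<^bsub>S\<^esub> h) \<otimes>\<^bsub>S\<^esub> k = f \<otimes>\<^bsub>S\<^esub> k \<oplus>\<^bsub>S\<^esub> h \<otimes>\<^bsub>S\<^esub> k"
    unfolding ops l[OF A(3)] l[OF A(4)] l[OF A(5)]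
    by (auto simp: sum.distrib[symmetric] distrib_right intro!: ext sum.cong)
  show "k \<otimes>\<^bsub>S\<^esub> (f \<oplus>\<^bsub>S\<^esub> h) = k \<otimes>\<^bsub>S\<^esub> f \<oplus>\<^bsub>S\<^esub> k \<otimes>\<^bsub>S\<^esub> h"
    unfolding ops r[OF A(3)] r[OF A(4)] r[OF A(5)] using C
    by (auto simp: sum.distrib[symmetric] distrib_left act_add subset_iff intro!: ext sum.cong)
qed

lemma ring_S: "ring S"
proof (rule ringI)
  show "abelian_group S"
  proof (rule abelian_groupI)
    fix f assume f: "f \<in> carrier S"
    then have "(\<lambda>m. - f m) \<in> carrier S" "(\<lambda>m. - f m) \<oplus>\<^bsub>S\<^esub> f = \<zero>\<^bsub>S\<^esub>"
      by (auto simp: carrier_iff ops)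
    then show "\<exists>h \<in> carrier S. h \<oplus>\<^bsub>S\<^esub> f = \<zero>\<^bsub>S\<^esub>" by blast
  qed (use add_closed in \<open>auto simp: ops carrier_iff add_ac\<close>)
  show "Group.monoid S"
    by (rule monoidI) (use mult_closed mult_assoc one_mult single_closed in \<open>auto simp: ops(4)\<close>)
qed (use distrib in auto)

text \<open>Over a group \<open>a\<close> determines the \<open>b\<close> with \<open>a b = m\<close>, which removes the sum over \<open>b\<close>.\<close>

lemma mult_group_eq:
  assumes "group M" and f: "f \<in> carrier S" and h: "h \<in> carrier S" and m: "m \<in> carrier M"
  shows "(f \<otimes>\<^bsub>S\<^esub> h) m = (\<Sum>a\<in>supp f. f a * act a (h (inv a \<otimes> m)))"
proof -
  interpret group M by fact
  note car = f[unfolded carrier_iff] h[unfolded carrier_iff]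
  define B where "B = supp h \<union> (\<lambda>a. inv a \<otimes> m) ` supp f"
  have B: "finite B" "B \<subseteq> carrier M" "supp h \<subseteq> B" using car m by (auto simp: B_def)
  have "(f \<otimes>\<^bsub>S\<^esub> h) m = (\<Sum>a\<in>supp f. \<Sum>b\<in>B. if a \<otimes> b = m then f a * act a (h b) else 0)"
    using car B by (intro mult_eq) auto
  also have "\<dots> = (\<Sum>a\<in>supp f. \<Sum>b\<in>B. if b = inv a \<otimes> m then f a * act a (h b) else 0)"
    using car B m by (intro sum.cong refl if_cong) (auto simp: subset_iff m_assoc[symmetric])
  also have "\<dots> = (\<Sum>a\<in>supp f. f a * act a (h (inv a \<otimes> m)))"
    using B by (intro sum.cong refl) (auto simp: sum.delta B_def)
  finally show ?thesis .
qed

end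

end

section \<open>Products of pure tensors\<close>

context
  fixes A :: "('k::field, 'a) module" and C :: "('k, 'b) module"
  assumes A: "ring A" "\<And>k a. a \<in> carrier A \<Longrightarrow> k \<odot>\<^bsub>A\<^esub> a \<in> carrier A"
    and C: "ring C" "\<And>k a. a \<in> carrier C \<Longrightarrow> k \<odot>\<^bsub>C\<^esub> a \<in> carrier C"
begin

interpretation A: ring A by (rule A)
interpretation C: ring C by (rule C)

abbreviation (input) free_ring :: "('k, 'a \<times> 'b \<Rightarrow> 'k) module" where
  "free_ring \<equiv> monoid_algebra (A \<times>\<times> C)"

lemma skew_action_free: "skew_action (A \<times>\<times> C) (\<lambda>_ r::'k. r)"
proof -
  interpret Group.monoid "A \<times>\<times> C"
    by (rule DirProd_monoid) (rule A.monoid_axioms C.monoid_axioms)+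
  show ?thesis by unfold_locales simp_all
qed

lemma ring_free: "ring free_ring"
  unfolding monoid_algebra_def by (rule skew_action.ring_S[OF skew_action_free])

lemma free_single_closed: "a \<in> carrier A \<Longrightarrow> x \<in> carrier C \<Longrightarrow> single (a, x) (k::'k) \<in> carrier free_ring"
  unfolding monoid_algebra_def by (rule skew_action.single_closed[OF skew_action_free]) simp

lemma free_single_mult:
  assumes "a \<in> carrier A" "x \<in> carrier C"
  shows "single (a, x) (1::'k) \<otimes>\<^bsub>free_ring\<^esub> single (a', x') 1 = single (a \<otimes>\<^bsub>A\<^esub> a', x \<otimes>\<^bsub>C\<^esub> x') 1"
  unfolding monoid_algebra_def using assms by (subst skew_action.single_mult[OF skew_action_free]) simp_all

text \<open>
  The generated ideal is the intersection of all ideals that contain the relations.  For this not to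
  be an empty intersection the relations must lie in the ring, so \<open>A\<close> and \<open>C\<close> have to be closed under
  scalar multiplication.
\<close>

lemma tensor_ideal_ideal: "ideal (tensor_ideal A C) free_ring"
proof -
  interpret F: ring free_ring by (rule ring_free)
  have "bilinear_relations A C \<subseteq> carrier free_ring"
    unfolding bilinear_relations_def Let_def
    by (intro Un_least subsetI; elim CollectE exE conjE; hypsubst;
        intro F.minus_closed F.a_closed free_single_closed) (simp_all add: A(2) C(2))
  then show ?thesis unfolding tensor_ideal_def by (rule F.genideal_ideal)
qed

lemma tensor_ops:
  "s \<otimes>\<^bsub>tensor_algebra A C\<^esub> t = s \<otimes>\<^bsub>free_ring Quot tensor_ideal A C\<^esub> t"
  "s \<oplus>\<^bsub>tensor_algebra A C\<^esub> t = s \<oplus>\<^bsub>free_ring Quot tensor_ideal A C\<^esub> t"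
  by (simp_all add: tensor_algebra_def Let_def ring.defs)

lemma pure_tensor_closed:
  assumes "a \<in> carrier A" "x \<in> carrier C"
  shows "pure_tensor A C a x \<in> carrier (free_ring Quot tensor_ideal A C)"
proof -
  interpret I: ideal "tensor_ideal A C" free_ring by (rule tensor_ideal_ideal)
  show ?thesis unfolding pure_tensor_def FactRing_def
    using free_single_closed[OF assms] I.a_subset by (simp add: I.a_rcosetsI)
qed

lemma pure_tensor_mult:
  assumes "a \<in> carrier A" "x \<in> carrier C" "a' \<in> carrier A" "x' \<in> carrier C"
  shows "pure_tensor A C a x \<otimes>\<^bsub>tensor_algebra A C\<^esub> pure_tensor A C a' x'
    = pure_tensor A C (a \<otimes>\<^bsub>A\<^esub> a') (x \<otimes>\<^bsub>C\<^esub> x')"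
proof -
  interpret I: ideal "tensor_ideal A C" free_ring by (rule tensor_ideal_ideal)
  show ?thesis
    unfolding tensor_ops pure_tensor_def FactRing_def
    using I.rcoset_mult_add[OF free_single_closed[OF assms(1,2), of 1] free_single_closed[OF assms(3,4), of 1]]
    by (simp add: free_single_mult assms)
qed

lemma pure_tensor_mult_add:
  assumes "a \<in> carrier A" "x \<in> carrier C" "a1 \<in> carrier A" "x1 \<in> carrier C" "a2 \<in> carrier A" "x2 \<in> carrier C"
  shows "pure_tensor A C a x \<otimes>\<^bsub>tensor_algebra A C\<^esub>
      (pure_tensor A C a1 x1 \<oplus>\<^bsub>tensor_algebra A C\<^esub> pure_tensor A C a2 x2)
    = pure_tensor A C (a \<otimes>\<^bsub>A\<^esub> a1) (x \<otimes>\<^bsub>C\<^esub> x1) \<oplus>\<^bsub>tensor_algebra A C\<^esub>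
      pure_tensor A C (a \<otimes>\<^bsub>A\<^esub> a2) (x \<otimes>\<^bsub>C\<^esub> x2)"
proof -
  interpret Q: ring "free_ring Quot tensor_ideal A C"
    by (rule ideal.quotient_is_ring[OF tensor_ideal_ideal])
  show ?thesis
    unfolding pure_tensor_mult[OF assms(1-4), symmetric]
      pure_tensor_mult[OF assms(1,2,5,6), symmetric]
    unfolding tensor_ops by (intro Q.r_distr pure_tensor_closed assms)
qed

end

section \<open>Ore extensions with trivial derivation\<close>

text \<open>
  Ore extensions whose derivation vanishes on the coefficients.  The axioms ask so little of \<open>R\<close>
  because they must hold again for the extension itself, in order to iterate the construction, at a
  point where the extension is not yet known to be associative.
\<close>

locale endo_ore = abelian_group R for R :: "('k, 'r) module" (structure) +
  fixes \<sigma> \<delta> :: "'r \<Rightarrow> 'r"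
  assumes R_mult_closed: "r \<in> carrier R \<Longrightarrow> s \<in> carrier R \<Longrightarrow> r \<otimes> s \<in> carrier R"
    and R_l_null: "r \<in> carrier R \<Longrightarrow> \<zero> \<otimes> r = \<zero>"
    and R_r_null: "r \<in> carrier R \<Longrightarrow> r \<otimes> \<zero> = \<zero>"
    and \<sigma>_closed: "r \<in> carrier R \<Longrightarrow> \<sigma> r \<in> carrier R"
    and \<sigma>_zero: "\<sigma> \<zero> = \<zero>"
    and \<delta>_zero: "r \<in> carrier R \<Longrightarrow> \<delta> r = \<zero>"
begin

abbreviation E :: "('k, nat \<Rightarrow> 'r) module" where "E \<equiv> ore_extension R \<sigma> \<delta>"

lemma ore_carrier_iff: "p \<in> carrier E \<longleftrightarrow> (\<forall>n. p n \<in> carrier R) \<and> finite {n. p n \<noteq> \<zero>}"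
  by (simp add: ore_extension_def)

lemma ore_ops:
  "p \<oplus>\<^bsub>E\<^esub> q = (\<lambda>n. p n \<oplus> q n)" "\<zero>\<^bsub>E\<^esub> = (\<lambda>_. \<zero>)" "k \<odot>\<^bsub>E\<^esub> p = (\<lambda>n. k \<odot> p n)"
  "\<one>\<^bsub>E\<^esub> = ore_const R \<one>"
  by (auto simp: ore_extension_def ore_const_def)

lemma ore_add_closed:
  assumes "p \<in> carrier E" "q \<in> carrier E"
  shows "p \<oplus>\<^bsub>E\<^esub> q \<in> carrier E"
proof -
  have "{n. p n \<oplus> q n \<noteq> \<zero>} \<subseteq> {n. p n \<noteq> \<zero>} \<union> {n. q n \<noteq> \<zero>}" by auto
  then show ?thesis using assms unfolding ore_carrier_iff ore_ops
    by (meson finite_UnI finite_subset a_closed)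
qed

lemma ore_abelian_group: "abelian_group E"
proof (rule abelian_groupI)
  fix p assume p: "p \<in> carrier E"
  then have "(\<lambda>n. \<ominus> p n) \<in> carrier E" "(\<lambda>n. \<ominus> p n) \<oplus>\<^bsub>E\<^esub> p = \<zero>\<^bsub>E\<^esub>"
    by (auto simp: ore_carrier_iff ore_ops l_neg elim!: finite_subset[rotated])
  then show "\<exists>q \<in> carrier E. q \<oplus>\<^bsub>E\<^esub> p = \<zero>\<^bsub>E\<^esub>" by blast
qed (use ore_add_closed in \<open>auto simp: ore_ops ore_carrier_iff a_ac\<close>)

lemma ore_finsum:
  assumes "F \<in> A \<rightarrow> carrier E"
  shows "finsum E F A n = (\<Oplus>i\<in>A. F i n)"
proof -
  interpret E: abelian_group E by (rule ore_abelian_group)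
  show ?thesis using assms
  proof (induction A rule: infinite_finite_induct)
    case (insert a A)
    have "F i \<in> carrier E" if "i \<in> insert a A" for i using insert.prems that by auto
    then have "(\<lambda>i. F i n) \<in> A \<rightarrow> carrier R" "F a n \<in> carrier R" by (simp_all add: ore_carrier_iff)
    with insert show ?case by (simp add: E.finsum_insert finsum_insert ore_ops)
  qed (auto simp: ore_ops)
qed

lemma \<sigma>_pow_closed: "r \<in> carrier R \<Longrightarrow> (\<sigma> ^^ i) r \<in> carrier R"
  by (induction i) (auto simp: \<sigma>_closed)

lemma \<sigma>_pow_zero: "(\<sigma> ^^ i) \<zero> = \<zero>"
  by (induction i) (auto simp: \<sigma>_zero)

lemma lmult_var_pow:
  assumes "q \<in> carrier E"
  shows "(ore_lmult_var R \<sigma> \<delta> ^^ i) q n = (if i \<le> n then (\<sigma> ^^ i) (q (n - i)) else \<zero>)"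
proof (induction i arbitrary: n)
  case (Suc i)
  have q: "q n \<in> carrier R" for n using assms by (simp add: ore_carrier_iff)
  have "(ore_lmult_var R \<sigma> \<delta> ^^ Suc i) q n =
      (case n of 0 \<Rightarrow> \<zero> | Suc m \<Rightarrow> \<sigma> ((ore_lmult_var R \<sigma> \<delta> ^^ i) q m)) \<oplus>
      \<delta> ((ore_lmult_var R \<sigma> \<delta> ^^ i) q n)"
    by (simp add: ore_lmult_var_def)
  then show ?case
    by (auto simp: Suc \<delta>_zero \<sigma>_pow_closed q \<sigma>_zero \<sigma>_closed split: nat.split)
qed simp

lemma ore_mult_eq:
  assumes p: "p \<in> carrier E" and q: "q \<in> carrier E"
  shows "(p \<otimes>\<^bsub>E\<^esub> q) n = (\<Oplus>i\<in>{..n}. p i \<otimes> (\<sigma> ^^ i) (q (n - i)))"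
proof -
  define G where "G i = p i \<otimes> (if i \<le> n then (\<sigma> ^^ i) (q (n - i)) else \<zero>)" for i
  have pq: "p n \<in> carrier R" "q n \<in> carrier R" for n using p q by (auto simp: ore_carrier_iff)
  have G: "G i \<in> carrier R" for i by (simp add: G_def R_mult_closed \<sigma>_pow_closed pq)
  have "(p \<otimes>\<^bsub>E\<^esub> q) n = (\<Oplus>i\<in>{i. p i \<noteq> \<zero>}. G i)"
    by (simp add: ore_extension_def lmult_var_pow[OF q, unfolded ore_extension_def] G_def)
  also have "\<dots> = (\<Oplus>i\<in>{i. p i \<noteq> \<zero>} \<union> {..n}. G i)"
    using p by (intro add.finprod_mono_neutral_cong_left)
      (auto simp: ore_carrier_iff G_def R_l_null R_mult_closed \<sigma>_pow_closed pq)
  also have "\<dots> = (\<Oplus>i\<in>{..n}. p i \<otimes> (\<sigma> ^^ i) (q (n - i)))"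
    using p by (intro add.finprod_mono_neutral_cong_right)
      (auto simp: ore_carrier_iff G_def R_r_null R_mult_closed \<sigma>_pow_closed pq)
  finally show ?thesis .
qed

lemma ore_mult_closed:
  assumes p: "p \<in> carrier E" and q: "q \<in> carrier E"
  shows "p \<otimes>\<^bsub>E\<^esub> q \<in> carrier E"
proof -
  have pq: "p n \<in> carrier R" "q n \<in> carrier R" for n using p q by (auto simp: ore_carrier_iff)
  let ?P = "(\<lambda>(i, j). i + j) ` ({i. p i \<noteq> \<zero>} \<times> {j. q j \<noteq> \<zero>})"
  have "{n. (p \<otimes>\<^bsub>E\<^esub> q) n \<noteq> \<zero>} \<subseteq> ?P"
  proof (rule subsetI, rule ccontr)
    fix n assume n: "n \<in> {n. (p \<otimes>\<^bsub>E\<^esub> q) n \<noteq> \<zero>}" and nP: "n \<notin> ?P"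
    have "p i \<otimes> (\<sigma> ^^ i) (q (n - i)) = \<zero>" if "i \<le> n" for i
    proof -
      have "p i = \<zero> \<or> q (n - i) = \<zero>" 
      proof (rule ccontr)
        assume "\<not> ?thesis"
        then have "(i, n - i) \<in> {i. p i \<noteq> \<zero>} \<times> {j. q j \<noteq> \<zero>}" by simp
        from image_eqI[OF _ this, of n "\<lambda>(i, j). i + j"] that nP show False by simp
      qed
      then show ?thesis by (metis R_l_null R_r_null \<sigma>_pow_zero \<sigma>_pow_closed pq)
    qed
    then have "(p \<otimes>\<^bsub>E\<^esub> q) n = (\<Oplus>i\<in>{..n}. \<zero>)"
      unfolding ore_mult_eq[OF p q] by (intro finsum_cong') simp_all
    also have "\<dots> = \<zero>" by (rule finsum_zero)
    finally show False using n by simp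
  qed
  then have "finite {n. (p \<otimes>\<^bsub>E\<^esub> q) n \<noteq> \<zero>}"
    by (rule finite_subset) (use p q in \<open>simp add: ore_carrier_iff\<close>)
  moreover have "(p \<otimes>\<^bsub>E\<^esub> q) n \<in> carrier R" for n
    unfolding ore_mult_eq[OF p q] by (intro finsum_closed) (auto simp: pq R_mult_closed \<sigma>_pow_closed)
  ultimately show ?thesis unfolding ore_carrier_iff by blast
qed

lemma ore_null:
  assumes p: "p \<in> carrier E"
  shows "\<zero>\<^bsub>E\<^esub> \<otimes>\<^bsub>E\<^esub> p = \<zero>\<^bsub>E\<^esub>" and "p \<otimes>\<^bsub>E\<^esub> \<zero>\<^bsub>E\<^esub> = \<zero>\<^bsub>E\<^esub>"
proof -
  have p': "p n \<in> carrier R" for n using p by (auto simp: ore_carrier_iff)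
  have z: "\<zero>\<^bsub>E\<^esub> \<in> carrier E" by (simp add: ore_carrier_iff ore_ops)
  show "\<zero>\<^bsub>E\<^esub> \<otimes>\<^bsub>E\<^esub> p = \<zero>\<^bsub>E\<^esub>" "p \<otimes>\<^bsub>E\<^esub> \<zero>\<^bsub>E\<^esub> = \<zero>\<^bsub>E\<^esub>"
    by (auto simp: fun_eq_iff ore_mult_eq p z[unfolded ore_ops] ore_ops R_l_null R_r_null p' \<sigma>_pow_closed \<sigma>_pow_zero)
qed

lemma ore_const_closed: "r \<in> carrier R \<Longrightarrow> ore_const R r \<in> carrier E"
  by (auto simp: ore_carrier_iff ore_const_def)

end

section \<open>The group algebra and its first Ore extension\<close>

locale hopf_data = group G for G :: "('g, 'm) monoid_scheme" (structure) +
  fixes \<chi> \<eta> :: "'g \<Rightarrow> 'k::field" and b c :: 'g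
  assumes chi: "\<chi> \<in> char_group G" and eta: "\<eta> \<in> char_group G"
    and b_center: "b \<in> group_center G"
    and c_center: "c \<in> group_center G"
    and eta_b: "\<eta> b = inverse (\<chi> c)"
begin

lemma c_in [simp]: "c \<in> carrier G"
  using c_center by (simp add: group_center_def)

lemma char_mult: "\<psi> \<in> char_group G \<Longrightarrow> g \<in> carrier G \<Longrightarrow> h \<in> carrier G \<Longrightarrow> \<psi> (g \<otimes> h) = \<psi> g * \<psi> h"
  by (simp add: char_group_def hom_def)

lemma char_nz: "\<psi> \<in> char_group G \<Longrightarrow> g \<in> carrier G \<Longrightarrow> \<psi> g \<noteq> 0"
  by (auto simp: char_group_def hom_def)

lemma char_one: "\<psi> \<in> char_group G \<Longrightarrow> \<psi> \<one> = 1"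
  using char_mult[of \<psi> \<one> \<one>] char_nz[of \<psi> \<one>] by simp

lemma char_pow: "\<psi> \<in> char_group G \<Longrightarrow> g \<in> carrier G \<Longrightarrow> \<psi> (g [^] (n::nat)) = \<psi> g ^ n"
  by (induction n) (simp_all add: char_one char_mult)

lemma char_inv:
  assumes "\<psi> \<in> char_group G" "g \<in> carrier G"
  shows "\<psi> (inv g) = inverse (\<psi> g)"
  using char_mult[OF assms(1), of g "inv g"] assms(2)
  by (simp add: char_one[OF assms(1)] inverse_unique[symmetric])

lemmas chi_simps = char_mult[OF chi] char_nz[OF chi] char_one[OF chi] char_pow[OF chi]
lemmas eta_simps = char_mult[OF eta] char_nz[OF eta] char_one[OF eta] char_pow[OF eta]

abbreviation KG :: "('k, 'g \<Rightarrow> 'k) module" where "KG \<equiv> monoid_algebra G"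
abbreviation B :: "('k, nat \<Rightarrow> 'g \<Rightarrow> 'k) module" where "B \<equiv> H_base G \<chi>"

sublocale KG: skew_action G "\<lambda>_ r::'k. r"
  by unfold_locales simp_all

lemmas KG_ring = KG.ring_S[where sc = "(*)", folded monoid_algebra_def]
lemmas KG_carrier_iff = KG.carrier_iff[where sc = "(*)", folded monoid_algebra_def]
lemmas KG_ops = KG.ops[where sc = "(*)", folded monoid_algebra_def]
lemmas KG_mult_eq = KG.mult_group_eq[OF is_group, where sc = "(*)", folded monoid_algebra_def]
lemmas KG_single_closed = KG.single_closed[where sc = "(*)", folded monoid_algebra_def]

lemma KG_finsum:
  assumes "F \<in> A \<rightarrow> carrier KG"
  shows "finsum KG F A g = (\<Sum>i\<in>A. F i g)"
proof -
  interpret ring KG by (rule KG_ring)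
  show ?thesis using assms
    by (induction A rule: infinite_finite_induct) (auto simp: finsum_insert Pi_iff KG_ops)
qed

sublocale base: endo_ore KG "tau_chi \<chi>" "\<lambda>_. \<zero>\<^bsub>KG\<^esub>"
proof -
  interpret ring KG by (rule KG_ring)
  have "tau_chi \<chi> r \<in> carrier KG" if "r \<in> carrier KG" for r
  proof -
    have "{m. tau_chi \<chi> r m \<noteq> 0} \<subseteq> {m. r m \<noteq> 0}" by (auto simp: tau_chi_def)
    then show ?thesis using that unfolding KG_carrier_iff by (meson finite_subset order_trans)
  qed
  then show "endo_ore KG (tau_chi \<chi>) (\<lambda>_. \<zero>\<^bsub>KG\<^esub>)"
    by unfold_locales (simp_all add: tau_chi_def KG_ops(2) l_null[unfolded KG_ops(2)] r_null[unfolded KG_ops(2)])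
qed

lemmas B_carrier_iff = base.ore_carrier_iff[folded H_base_def]
lemmas B_ops = base.ore_ops[folded H_base_def]
lemmas B_group = base.ore_abelian_group[folded H_base_def]
lemmas B_mult_eq = base.ore_mult_eq[folded H_base_def]
lemmas B_mult_closed = base.ore_mult_closed[folded H_base_def]
lemmas B_null = base.ore_null[folded H_base_def]
lemmas B_finsum = base.ore_finsum[folded H_base_def]

lemma base_coeff_in: "p \<in> carrier B \<Longrightarrow> p m \<in> carrier KG"
  by (simp add: B_carrier_iff)

lemma tau_chi_pow: "(tau_chi \<chi> ^^ i) f = (\<lambda>g. \<chi> g ^ i * f g)"
  by (induction i) (auto simp: tau_chi_def)

lemma tau_eta_pow: "(tau_eta \<eta> b ^^ i) p = (\<lambda>m g. \<eta> b ^ (m * i) * (\<eta> g ^ i * p m g))"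
  by (induction i) (auto simp: tau_eta_def power_add mult_ac)

text \<open>
  This is the rule \<open>(a x\<^sup>i) (g x\<^sup>j) = \<chi>(g)\<^sup>i a g x\<^sup>i\<^sup>+\<^sup>j\<close>, summed over all terms.
\<close>

lemma base_mult_coeff:
  assumes p: "p \<in> carrier B" and q: "q \<in> carrier B" and g: "g \<in> carrier G"
  shows "(p \<otimes>\<^bsub>B\<^esub> q) m g
    = (\<Sum>i\<le>m. \<Sum>a | p i a \<noteq> 0. p i a * (\<chi> (inv a \<otimes> g) ^ i * q (m - i) (inv a \<otimes> g)))"
proof -
  interpret ring KG by (rule KG_ring)
  have cl: "p i \<in> carrier KG" "(tau_chi \<chi> ^^ i) (q j) \<in> carrier KG" for i j
    using p q by (auto simp: base_coeff_in base.\<sigma>_pow_closed)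
  have "(p \<otimes>\<^bsub>B\<^esub> q) m g = (\<Sum>i\<le>m. (p i \<otimes>\<^bsub>KG\<^esub> (tau_chi \<chi> ^^ i) (q (m - i))) g)"
    unfolding B_mult_eq[OF p q] by (rule KG_finsum) (simp add: cl)
  also have "\<dots> = (\<Sum>i\<le>m. \<Sum>a | p i a \<noteq> 0. p i a * (\<chi> (inv a \<otimes> g) ^ i * q (m - i) (inv a \<otimes> g)))"
    by (simp only: KG_mult_eq[OF cl g]) (simp only: tau_chi_pow)
  finally show ?thesis .
qed

lemma tau_eta_closed:
  assumes "p \<in> carrier B"
  shows "tau_eta \<eta> b p \<in> carrier B"
proof -
  have "tau_eta \<eta> b p n \<in> carrier KG" for n
  proof -
    have "{m. tau_eta \<eta> b p n m \<noteq> 0} \<subseteq> {m. p n m \<noteq> 0}" by (auto simp: tau_eta_def)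
    then show ?thesis using base_coeff_in[OF assms, of n] unfolding KG_carrier_iff
      by (meson finite_subset order_trans)
  qed
  moreover have "{n. tau_eta \<eta> b p n \<noteq> (\<lambda>_. 0)} \<subseteq> {n. p n \<noteq> (\<lambda>_. 0)}"
    by (auto simp: tau_eta_def)
  ultimately show ?thesis using assms unfolding B_carrier_iff KG_ops(2) by (meson finite_subset)
qed

end

section \<open>The derivation vanishes\<close>

context hopf_data
begin

definition base_monom :: "('g \<Rightarrow> 'k) \<Rightarrow> nat \<Rightarrow> nat \<Rightarrow> 'g \<Rightarrow> 'k" where
  "base_monom f n = (\<lambda>k. if k = n then f else (\<lambda>_. 0))"

lemma base_monom_closed: "f \<in> carrier KG \<Longrightarrow> base_monom f n \<in> carrier B"
  by (auto simp: B_carrier_iff base_monom_def KG_ops KG_carrier_iff)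

lemma base_x_closed: "base_x G \<in> carrier B"
proof -
  have "base_x G = base_monom (single \<one> 1) 1"
    by (auto simp: base_x_def ore_var_def base_monom_def KG_ops)
  then show ?thesis by (simp add: base_monom_closed KG_single_closed)
qed

lemma base_x_mult_monom:
  assumes f: "f \<in> carrier KG"
  shows "base_x G \<otimes>\<^bsub>B\<^esub> base_monom f n = base_monom (tau_chi \<chi> f) (Suc n)"
proof
  fix k
  interpret ring KG by (rule KG_ring)
  let ?L = "ore_lmult_var KG (tau_chi \<chi>) (\<lambda>_. \<zero>\<^bsub>KG\<^esub>)"
  have one_nz: "single \<one> (1::'k) \<noteq> (\<lambda>_. 0)" by (auto simp: single_def fun_eq_iff)
  then have supp: "{i. (base_x G :: nat \<Rightarrow> 'g \<Rightarrow> 'k) i \<noteq> \<zero>\<^bsub>KG\<^esub>} = {1}"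
    by (auto simp: base_x_def ore_var_def KG_ops)
  have L: "?L (base_monom f n) k = base_monom (tau_chi \<chi> f) (Suc n) k"
    by (auto simp: ore_lmult_var_def base_monom_def KG_ops tau_chi_def fun_eq_iff split: nat.split)
  have Lc: "base_monom (tau_chi \<chi> f) (Suc n) k \<in> carrier KG"
    using base.\<sigma>_closed[OF f] by (simp add: base_monom_closed base_coeff_in)
  have "(base_x G \<otimes>\<^bsub>B\<^esub> base_monom f n) k
      = finsum KG (\<lambda>i. base_x G i \<otimes>\<^bsub>KG\<^esub> (?L ^^ i) (base_monom f n) k) {1}"
    unfolding H_base_def ore_extension_def by (simp add: supp)
  also have "\<dots> = base_monom (tau_chi \<chi> f) (Suc n) k"
    using Lc by (simp add: base_x_def ore_var_def L)
  finally show "(base_x G \<otimes>\<^bsub>B\<^esub> base_monom f n) k = base_monom (tau_chi \<chi> f) (Suc n) k" .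
qed

text \<open>
  On the basis elements \<open>g x\<^sup>n\<close> the claim follows by induction on \<open>n\<close>: since \<open>\<tau>\<^sub>\<chi>\<close> only rescales \<open>g\<close>,
  the element \<open>g x\<^sup>n\<^sup>+\<^sup>1\<close> is \<open>x\<close> times a multiple of \<open>g x\<^sup>n\<close>, and the Leibniz rule applies.
\<close>

lemma derivation_trivial:
  assumes \<delta>: "H_derivation G \<chi> \<eta> b c \<beta> \<delta>" and triv: "\<beta> = 0 \<or> c = inv b" and r: "r \<in> carrier B"
  shows "\<delta> r = \<zero>\<^bsub>B\<^esub>"
proof -
  interpret B: abelian_group B by (rule B_group)
  have b: "b \<in> carrier G" using b_center by (simp add: group_center_def)
  have add: "\<delta> (r \<oplus>\<^bsub>B\<^esub> s) = \<delta> r \<oplus>\<^bsub>B\<^esub> \<delta> s"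
    and mult: "\<delta> (r \<otimes>\<^bsub>B\<^esub> s) = tau_eta \<eta> b r \<otimes>\<^bsub>B\<^esub> \<delta> s \<oplus>\<^bsub>B\<^esub> \<delta> r \<otimes>\<^bsub>B\<^esub> s"
    and smult: "\<delta> (k \<odot>\<^bsub>B\<^esub> r) = k \<odot>\<^bsub>B\<^esub> \<delta> r"
    if "r \<in> carrier B" "s \<in> carrier B" for r s k
    using \<delta> that by (auto simp: H_derivation_def skew_derivation_def)
  have smult_zero: "k \<odot>\<^bsub>B\<^esub> \<zero>\<^bsub>B\<^esub> = \<zero>\<^bsub>B\<^esub>" for k
    by (simp add: B_ops KG_ops)
  have emb_closed: "base_emb G f \<in> carrier B" if "f \<in> carrier KG" for f
    unfolding base_emb_def using base.ore_const_closed[OF that] by (simp add: H_base_def)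
  have \<delta>x: "\<delta> (base_x G) = \<zero>\<^bsub>B\<^esub>"
  proof -
    have "\<delta> (base_x G) = \<beta> \<odot>\<^bsub>B\<^esub> (\<one>\<^bsub>B\<^esub> \<ominus>\<^bsub>B\<^esub> base_emb G (single (c \<otimes> b) 1))"
      using \<delta> by (simp add: H_derivation_def)
    also have "\<dots> = \<zero>\<^bsub>B\<^esub>"
      using triv
    proof
      assume "c = inv b"
      then have "base_emb G (single (c \<otimes> b) 1) = \<one>\<^bsub>B\<^esub>" using b by (simp add: B_ops KG_ops base_emb_def)
      moreover have "\<one>\<^bsub>B\<^esub> \<in> carrier B"
        using emb_closed[of "single \<one> 1"] by (simp add: B_ops KG_ops base_emb_def KG_single_closed)
      ultimately show ?thesis by (simp add: a_minus_def B.r_neg smult_zero)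
    qed (simp add: B_ops KG_ops)
    finally show ?thesis .
  qed
  have single: "\<delta> (base_monom (single g k) n) = \<zero>\<^bsub>B\<^esub>" if g: "g \<in> carrier G" for g k n
  proof (induction n arbitrary: k)
    case 0
    have "base_monom (single g k) 0 = k \<odot>\<^bsub>B\<^esub> base_emb G (single g 1)"
      by (auto simp: base_monom_def base_emb_def ore_const_def B_ops KG_ops single_def fun_eq_iff)
    then show ?case
      using \<delta> g smult[OF emb_closed emb_closed, of "single g 1" "single g 1" k]
      by (simp add: H_derivation_def KG_single_closed smult_zero)
  next
    case (Suc n)
    \<comment> \<open>The coefficient \<open>k / \<chi> g\<close> compensates \<open>x g = \<chi>(g) g x\<close>.\<close>
    let ?m = "base_monom (single g (k / \<chi> g)) n"
    have m: "?m \<in> carrier B" using g by (simp add: base_monom_closed KG_single_closed)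
    have "tau_chi \<chi> (single g (k / \<chi> g)) = single g k"
      using g by (auto simp: tau_chi_def single_def chi_simps)
    then have "base_monom (single g k) (Suc n) = base_x G \<otimes>\<^bsub>B\<^esub> ?m"
      using g by (simp add: base_x_mult_monom KG_single_closed)
    then show ?case
      using mult[OF base_x_closed m] Suc m
      by (simp add: \<delta>x B_null tau_eta_closed base_x_closed)
  qed
  have zero: "\<delta> \<zero>\<^bsub>B\<^esub> = \<zero>\<^bsub>B\<^esub>"
    using smult[OF B.zero_closed B.zero_closed, of 0] by (simp add: B_ops KG_ops)
  have monom: "\<delta> (base_monom f n) = \<zero>\<^bsub>B\<^esub>" if "f \<in> carrier KG" for f n
  proof -
    have "finite {g. f g \<noteq> 0}" "{g. f g \<noteq> 0} \<subseteq> carrier G" using that by (auto simp: KG_carrier_iff)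
    then show ?thesis
    proof (induction f rule: finite_support_induct)
      case zero
      have "base_monom (\<lambda>_. 0) n = \<zero>\<^bsub>B\<^esub>" by (auto simp: base_monom_def B_ops KG_ops)
      then show ?case using \<open>\<delta> \<zero>\<^bsub>B\<^esub> = \<zero>\<^bsub>B\<^esub>\<close> by simp
    next
      case (step f g)
      show ?case
      proof (cases "f g = 0")
        case True
        then have "f(g := 0) = f" by auto
        then show ?thesis using step by simp
      next
        case False
        then have g: "g \<in> carrier G" using step.prems by auto
        have sub: "{h. (f(g := 0)) h \<noteq> 0} \<subseteq> {h. f h \<noteq> 0}" by auto
        then have f': "f(g := 0) \<in> carrier KG"
          using step.prems finite_subset[OF sub step.hyps] unfolding KG_carrier_iff by blast
        have "base_monom f n = base_monom (f(g := 0)) n \<oplus>\<^bsub>B\<^esub> base_monom (single g (f g)) n"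
          by (auto simp: base_monom_def B_ops KG_ops single_def fun_eq_iff)
        moreover have "\<delta> (base_monom (f(g := 0)) n) = \<zero>\<^bsub>B\<^esub>"
          by (rule step.IH) (use step.prems in auto)
        ultimately show ?thesis
          using add[OF base_monom_closed[OF f'] base_monom_closed[OF KG_single_closed[OF g]]]
          by (simp add: single[OF g])
      qed
    qed
  qed
  have "finite {n. r n \<noteq> (\<lambda>_. 0)}" "\<And>n. r n \<in> carrier KG" using r by (auto simp: B_carrier_iff KG_ops)
  then show ?thesis
  proof (induction r rule: finite_support_induct)
    case zero
    then show ?case using \<open>\<delta> \<zero>\<^bsub>B\<^esub> = \<zero>\<^bsub>B\<^esub>\<close> by (simp add: B_ops KG_ops)
  next
    case (step r n)
    have "{k. (r(n := \<lambda>_. 0)) k \<noteq> (\<lambda>_. 0)} \<subseteq> {k. r k \<noteq> (\<lambda>_. 0)}" by auto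
    then have fin: "finite {k. (r(n := \<lambda>_. 0)) k \<noteq> (\<lambda>_. 0)}" using step.hyps by (rule finite_subset)
    have cl: "(r(n := \<lambda>_. 0)) k \<in> carrier KG" for k using step.prems by (simp add: KG_carrier_iff)
    have r': "r(n := \<lambda>_. 0) \<in> carrier B" unfolding B_carrier_iff KG_ops using fin cl by blast
    have "r = r(n := \<lambda>_. 0) \<oplus>\<^bsub>B\<^esub> base_monom (r n) n"
      by (auto simp: base_monom_def B_ops KG_ops fun_eq_iff)
    from arg_cong[OF this, of \<delta>] add[OF r' base_monom_closed[OF step.prems]]
    have "\<delta> r = \<delta> (r(n := \<lambda>_. 0)) \<oplus>\<^bsub>B\<^esub> \<delta> (base_monom (r n) n)" by (rule trans)
    also have "\<dots> = \<zero>\<^bsub>B\<^esub>" by (simp only: step.IH[OF cl] monom step.prems B.l_zero B.zero_closed)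
    finally show ?case .
  qed
qed

end

section \<open>The skew group ring \<open>K[x, z] # G\<close>\<close>

context hopf_data
begin

text \<open>
  The action is diagonal on monomials, which reduces its algebraic properties to identities between
  powers of \<open>\<chi>(g)\<close> and \<open>\<eta>(g)\<close>.
\<close>

lemma cf_poly_act: "cf (poly_act \<chi> \<eta> g p) n m = inverse (\<chi> g) ^ m * inverse (\<eta> g) ^ n * cf p n m"
  by (simp add: poly_act_def coeff_pcompose_linear coeff_map_poly poly_const_pow mult_ac)

sublocale PS: skew_action G "poly_act \<chi> \<eta>"
proof
  fix a r s assume a: "a \<in> carrier G"
  show "poly_act \<chi> \<eta> a (r + s) = poly_act \<chi> \<eta> a r + poly_act \<chi> \<eta> a s"
    by (rule poly_poly_eqI) (simp add: cf_poly_act algebra_simps)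
  show "poly_act \<chi> \<eta> a (r * s) = poly_act \<chi> \<eta> a r * poly_act \<chi> \<eta> a s"
  proof (rule poly_poly_eqI)
    fix n m
    have "inverse (\<chi> a) ^ m * inverse (\<eta> a) ^ n * (cf r j i * cf s (n - j) (m - i))
      = cf (poly_act \<chi> \<eta> a r) j i * cf (poly_act \<chi> \<eta> a s) (n - j) (m - i)"
      if "j \<le> n" "i \<le> m" for j i
    proof -
      have "n = j + (n - j)" "m = i + (m - i)" using that by simp_all
      then have "inverse (\<chi> a) ^ m = inverse (\<chi> a) ^ i * inverse (\<chi> a) ^ (m - i)"
        "inverse (\<eta> a) ^ n = inverse (\<eta> a) ^ j * inverse (\<eta> a) ^ (n - j)"
        by (metis power_add)+
      then show ?thesis by (simp only: cf_poly_act mult_ac)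
    qed
    then show "cf (poly_act \<chi> \<eta> a (r * s)) n m = cf (poly_act \<chi> \<eta> a r * poly_act \<chi> \<eta> a s) n m"
      by (simp only: cf_poly_act[of a "r * s"] cf_mult sum_distrib_left) (auto intro!: sum.cong)
  qed
  show "poly_act \<chi> \<eta> a 1 = 1"
    by (rule poly_poly_eqI) (auto simp: cf_poly_act intro!: gr0I)
  fix a' assume "a' \<in> carrier G"
  with a show "poly_act \<chi> \<eta> (a \<otimes> a') r = poly_act \<chi> \<eta> a (poly_act \<chi> \<eta> a' r)"
    by (intro poly_poly_eqI) (simp only: cf_poly_act char_mult[OF chi] char_mult[OF eta]
        inverse_mult_distrib power_mult_distrib mult_ac)
next
  show "poly_act \<chi> \<eta> \<one> r = r" for r
    by (rule poly_poly_eqI) (simp add: cf_poly_act chi_simps eta_simps)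
qed

abbreviation S :: "('k, 'g \<Rightarrow> 'k poly poly) module" where "S \<equiv> poly_skew_group_ring G \<chi> \<eta>"

lemmas S_ring = PS.ring_S[where sc = "\<lambda>k. Polynomial.smult [:k:]", folded poly_skew_group_ring_def]
lemmas S_carrier_iff = PS.carrier_iff[where sc = "\<lambda>k. Polynomial.smult [:k:]", folded poly_skew_group_ring_def]
lemmas S_ops = PS.ops[where sc = "\<lambda>k. Polynomial.smult [:k:]", folded poly_skew_group_ring_def]
lemmas S_mult_eq = PS.mult_group_eq[OF is_group, where sc = "\<lambda>k. Polynomial.smult [:k:]", folded poly_skew_group_ring_def]
lemmas S_single_mult = PS.single_mult[where sc = "\<lambda>k. Polynomial.smult [:k:]", folded poly_skew_group_ring_def]
lemmas S_value_out = PS.carrier_value_out[where sc = "\<lambda>k. Polynomial.smult [:k:]", folded poly_skew_group_ring_def]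

lemma single_add: "single g r \<oplus>\<^bsub>S\<^esub> single g s = single g (r + s)"
  by (auto simp: S_ops single_def)

text \<open>
  Horner's scheme in \<open>x\<close>, then in \<open>z\<close>, produces every polynomial, and multiplication by \<open>g\<close> on the
  right every term.
\<close>

lemma S_generated:
  assumes add: "\<And>u v. u \<in> V \<Longrightarrow> v \<in> V \<Longrightarrow> u \<oplus>\<^bsub>S\<^esub> v \<in> V"
    and mult: "\<And>u v. u \<in> V \<Longrightarrow> v \<in> V \<Longrightarrow> u \<otimes>\<^bsub>S\<^esub> v \<in> V"
    and x: "single \<one> poly_x \<in> V" and z: "single \<one> poly_z \<in> V"
    and const: "\<And>g k. g \<in> carrier G \<Longrightarrow> single g [:[:k:]:] \<in> V"
  shows "carrier S \<subseteq> V"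
proof
  have mult1: "single \<one> (r * s) \<in> V" if "single \<one> r \<in> V" "single \<one> s \<in> V" for r s
    using mult[OF that] by (simp add: S_single_mult PS.act_one)
  have inner: "single \<one> [:s:] \<in> V" for s
  proof (induction s)
    case 0
    then show ?case using const[of \<one> 0] by simp
  next
    case (pCons k s)
    have "[:pCons k s:] = [:[:k:]:] + poly_x * [:s:]" by (simp add: poly_x_def)
    then show ?case
      using add[OF const[OF one_closed, of k] mult1[OF x pCons(2)]] by (simp add: single_add)
  qed
  have outer: "single \<one> r \<in> V" for r
  proof (induction r)
    case 0
    then show ?case using const[of \<one> 0] by simp
  next
    case (pCons s r)
    have "pCons s r = [:s:] + poly_z * r" by (simp add: poly_z_def)
    then show ?case using add[OF inner[of s] mult1[OF z pCons(2)]] by (simp add: single_add)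
  qed
  have terms: "single g r \<in> V" if g: "g \<in> carrier G" for g r
    using mult[OF outer[of r] const[OF g, of 1]] g
    by (simp add: S_single_mult PS.act_one flip: one_pCons)
  fix f assume "f \<in> carrier S"
  then have "finite {m. f m \<noteq> 0}" "{m. f m \<noteq> 0} \<subseteq> carrier G" by (auto simp: S_carrier_iff)
  then show "f \<in> V"
  proof (induction f rule: finite_support_induct)
    case zero
    have "single \<one> 0 = (\<lambda>_. 0 :: 'k poly poly)" by (auto simp: single_def)
    then show ?case using outer[of 0] by simp
  next
    case (step f g)
    show ?case
    proof (cases "f g = 0")
      case True
      then have "f(g := 0) = f" by auto
      then show ?thesis using step by simp
    next
      case False
      then have "single g (f g) \<in> V" using step.prems terms[of g] by auto
      moreover have "f(g := 0) \<in> V" by (rule step.IH) (use step.prems in auto)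
      moreover have "f = f(g := 0) \<oplus>\<^bsub>S\<^esub> single g (f g)" by (auto simp: S_ops single_def)
      ultimately show ?thesis using add by metis
    qed
  qed
qed

end

section \<open>Coefficients in \<open>H\<close>\<close>

locale hopf_trivial_derivation = hopf_data G \<chi> \<eta> b c
  for G :: "('g, 'm) monoid_scheme" (structure) and \<chi> \<eta> :: "'g \<Rightarrow> 'k::field" and b c :: 'g +
  fixes \<delta> :: "(nat \<Rightarrow> 'g \<Rightarrow> 'k) \<Rightarrow> nat \<Rightarrow> 'g \<Rightarrow> 'k"
  assumes \<delta>_trivial: "r \<in> carrier B \<Longrightarrow> \<delta> r = \<zero>\<^bsub>B\<^esub>"
begin

abbreviation H :: "('k, nat \<Rightarrow> nat \<Rightarrow> 'g \<Rightarrow> 'k) module" where "H \<equiv> H_alg G \<chi> \<eta> b \<delta>"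

sublocale top: endo_ore B "tau_eta \<eta> b" \<delta>
proof -
  interpret abelian_group B by (rule B_group)
  show "endo_ore B (tau_eta \<eta> b) \<delta>"
    by unfold_locales (use B_mult_closed B_null tau_eta_closed \<delta>_trivial
      in \<open>auto simp: tau_eta_def B_ops(2) KG_ops(2)\<close>)
qed

lemmas H_ops = top.ore_ops[folded H_alg_def]
lemmas H_mult_closed = top.ore_mult_closed[folded H_alg_def]

text \<open>
  The coefficient of \<open>g x\<^sup>m y\<^sup>n\<close> in \<open>p\<close> is \<open>p n m g\<close>: the exponent of the outer variable \<open>y\<close> comes first.
\<close>

lemma H_carrier_iff:
  "p \<in> carrier H \<longleftrightarrow> (\<forall>n m g. p n m g \<noteq> 0 \<longrightarrow> g \<in> carrier G) \<and> (\<forall>n m. finite {g. p n m g \<noteq> 0})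
    \<and> (\<forall>n. finite {m. p n m \<noteq> (\<lambda>_. 0)}) \<and> finite {n. p n \<noteq> (\<lambda>_ _. 0)}"
  unfolding top.ore_carrier_iff[folded H_alg_def] B_carrier_iff KG_carrier_iff B_ops(2) KG_ops(2)
  by blast

lemma H_coeff_in: "p \<in> carrier H \<Longrightarrow> p n \<in> carrier B"
  by (simp add: top.ore_carrier_iff[folded H_alg_def])

lemma H_value_out: "p \<in> carrier H \<Longrightarrow> g \<notin> carrier G \<Longrightarrow> p n m g = 0"
  by (auto simp: H_carrier_iff)

text \<open>
  This is the rule \<open>(a x\<^sup>i y\<^sup>j) (g x\<^sup>k y\<^sup>l) = \<chi>(g)\<^sup>i \<eta>(b)\<^sup>k\<^sup>j \<eta>(g)\<^sup>j a g x\<^sup>i\<^sup>+\<^sup>k y\<^sup>j\<^sup>+\<^sup>l\<close>, summed over all terms.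
\<close>

lemma H_mult_coeff:
  assumes p: "p \<in> carrier H" and q: "q \<in> carrier H" and g: "g \<in> carrier G"
  shows "(p \<otimes>\<^bsub>H\<^esub> q) n m g
    = (\<Sum>j\<le>n. \<Sum>i\<le>m. \<Sum>a | p j i a \<noteq> 0. p j i a * (\<chi> (inv a \<otimes> g) ^ i *
        (\<eta> b ^ ((m - i) * j) * (\<eta> (inv a \<otimes> g) ^ j * q (n - j) (m - i) (inv a \<otimes> g)))))"
proof -
  interpret KG: ring KG by (rule KG_ring)
  have cl: "p j \<in> carrier B" "(tau_eta \<eta> b ^^ i) (q j) \<in> carrier B" for i j
    using p q by (auto simp: H_coeff_in top.\<sigma>_pow_closed)
  have "(p \<otimes>\<^bsub>H\<^esub> q) n m g = (\<Sum>j\<le>n. (p j \<otimes>\<^bsub>B\<^esub> (tau_eta \<eta> b ^^ j) (q (n - j))) m g)"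
    unfolding top.ore_mult_eq[folded H_alg_def, OF p q]
    by (subst B_finsum, force simp: cl B_mult_closed, subst KG_finsum)
       (use cl in \<open>auto simp: B_mult_closed intro!: base_coeff_in\<close>)
  also have "\<dots> = (\<Sum>j\<le>n. \<Sum>i\<le>m. \<Sum>a | p j i a \<noteq> 0. p j i a * (\<chi> (inv a \<otimes> g) ^ i *
        (\<eta> b ^ ((m - i) * j) * (\<eta> (inv a \<otimes> g) ^ j * q (n - j) (m - i) (inv a \<otimes> g)))))"
    by (simp only: base_mult_coeff[OF cl g]) (simp only: tau_eta_pow)
  finally show ?thesis .
qed

lemma H_closed:
  "\<zero>\<^bsub>H\<^esub> \<in> carrier H" "p \<in> carrier H \<Longrightarrow> q \<in> carrier H \<Longrightarrow> p \<oplus>\<^bsub>H\<^esub> q \<in> carrier H"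
  using top.ore_abelian_group[folded H_alg_def, THEN abelian_group.axioms(1)]
  by (auto simp: abelian_monoid.zero_closed abelian_monoid.a_closed)

lemma H_op_values:
  "(p \<oplus>\<^bsub>H\<^esub> q) n m g = p n m g + q n m g" "\<zero>\<^bsub>H\<^esub> n m g = 0" "(k \<odot>\<^bsub>H\<^esub> p) n m g = k * p n m g"
  by (simp_all add: H_ops B_ops KG_ops)

lemma H_smult_closed:
  assumes "p \<in> carrier H"
  shows "k \<odot>\<^bsub>H\<^esub> p \<in> carrier H"
proof -
  have 1: "{g. (k \<odot>\<^bsub>H\<^esub> p) n m g \<noteq> 0} \<subseteq> {g. p n m g \<noteq> 0}" for n m by (auto simp: H_op_values)
  have 2: "{m. (k \<odot>\<^bsub>H\<^esub> p) n m \<noteq> (\<lambda>_. 0)} \<subseteq> {m. p n m \<noteq> (\<lambda>_. 0)}" for n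
    by (auto simp: H_op_values fun_eq_iff)
  have 3: "{n. (k \<odot>\<^bsub>H\<^esub> p) n \<noteq> (\<lambda>_ _. 0)} \<subseteq> {n. p n \<noteq> (\<lambda>_ _. 0)}"
    by (auto simp: H_op_values fun_eq_iff)
  show ?thesis using assms finite_subset[OF 1] finite_subset[OF 2] finite_subset[OF 3]
    unfolding H_carrier_iff by (auto simp: H_op_values(3))
qed

lemma H_emb_value: "H_emb G \<chi> f n m g = (if n = 0 \<and> m = 0 then f g else 0)"
  by (auto simp: H_emb_def base_emb_def ore_const_def B_ops KG_ops)

lemma H_x_value: "H_x G \<chi> n m g = (if n = 0 \<and> m = 1 \<and> g = \<one> then 1 else 0)"
  by (auto simp: H_x_def base_x_def ore_const_def ore_var_def B_ops KG_ops single_def)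

lemma H_y_value: "H_y G \<chi> n m g = (if n = 1 \<and> m = 0 \<and> g = \<one> then 1 else 0)"
  by (auto simp: H_y_def ore_const_def ore_var_def B_ops KG_ops single_def)

lemma H_one: "\<one>\<^bsub>H\<^esub> = H_grp G \<chi> \<one>"
  by (simp add: H_ops B_ops KG_ops H_grp_def H_emb_def base_emb_def)

lemma H_emb_closed: "f \<in> carrier KG \<Longrightarrow> H_emb G \<chi> f \<in> carrier H"
  unfolding H_emb_def base_emb_def
  by (intro top.ore_const_closed[folded H_alg_def] base.ore_const_closed[folded H_base_def])

lemma H_grp_closed: "g \<in> carrier G \<Longrightarrow> H_grp G \<chi> g \<in> carrier H"
  unfolding H_grp_def by (intro H_emb_closed KG_single_closed)

lemma carrier_if_value_nz_once:
  assumes "\<And>n m g. p n m g \<noteq> 0 \<Longrightarrow> n = n0 \<and> m = m0 \<and> g = \<one>"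
  shows "p \<in> carrier H"
proof -
  have sub: "{g. p n m g \<noteq> 0} \<subseteq> {\<one>}" "{m. p n m \<noteq> (\<lambda>_. 0)} \<subseteq> {m0}"
    "{n. p n \<noteq> (\<lambda>_ _. 0)} \<subseteq> {n0}" for n m
    using assms by (auto simp: fun_eq_iff)
  show ?thesis
    unfolding H_carrier_iff using assms sub[THEN finite_subset] by (simp, blast)
qed

lemma H_x_closed: "H_x G \<chi> \<in> carrier H"
  by (rule carrier_if_value_nz_once[of _ 0 1]) (simp add: H_x_value split: if_splits)

lemma H_y_closed: "H_y G \<chi> \<in> carrier H"
  by (rule carrier_if_value_nz_once[of _ 1 0]) (simp add: H_y_value split: if_splits)

end

section \<open>The isomorphism\<close>

context hopf_data
begin

lemma cpow_in [simp]: "c [^] (n::nat) \<in> carrier G" "inv (c [^] n) \<in> carrier G"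
  by simp_all

lemma cpow_commutes: "g \<in> carrier G \<Longrightarrow> c [^] (n::nat) \<otimes> g = g \<otimes> c [^] n"
proof (induction n)
  case (Suc n)
  have "c \<otimes> g = g \<otimes> c" using c_center Suc.prems by (simp add: group_center_def)
  then show ?case using Suc by (simp add: m_assoc) (simp add: m_assoc[symmetric])
qed simp

text \<open>
  The scalar by which \<open>g x\<^sup>m y\<^sup>n\<close> differs from \<open>x\<^sup>m z\<^sup>n g c\<^sup>n\<close>.  The triangular number counts the steps in
  which the \<open>n\<close> factors \<open>c\<close> of \<open>y\<^sup>n = (c z)\<^sup>n\<close> move to the right of the factors \<open>z\<close>.
\<close>

definition weight :: "nat \<Rightarrow> nat \<Rightarrow> 'g \<Rightarrow> 'k" where
  "weight n m g = inverse (\<eta> c ^ triangle n * \<chi> g ^ m * \<eta> g ^ n)"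

lemma weight_nz: "g \<in> carrier G \<Longrightarrow> weight n m g \<noteq> 0"
  by (simp add: weight_def chi_simps eta_simps)

text \<open>
  The product of \<open>a x\<^sup>m y\<^sup>n\<close> and \<open>v x\<^sup>m\<^sup>' y\<^sup>n\<^sup>'\<close> is weighted on the left after multiplying in \<open>H\<close> and on
  the right before multiplying in \<open>K[x, z] # G\<close>.  Taking out the common factors, what remains is
  \<open>\<eta>(b)\<^sup>m\<^sup>'\<^sup>n = \<chi>(c)\<^sup>-\<^sup>m\<^sup>'\<^sup>n\<close> and the cross term \<open>\<eta>(c)\<^sup>-\<^sup>n\<^sup>n\<^sup>'\<close>, which \<open>triangle (n + n')\<close> accounts for.
\<close>

lemma weight_add:
  assumes a: "a \<in> carrier G" and v: "v \<in> carrier G"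
  shows "weight (n + n') (m + m') (a \<otimes> v) * (\<chi> v ^ m * (\<eta> b ^ (m' * n) * \<eta> v ^ n))
    = weight n m a * (inverse (\<chi> (a \<otimes> c [^] n)) ^ m' * inverse (\<eta> (a \<otimes> c [^] n)) ^ n' * weight n' m' v)"
  using a v
  by (simp add: weight_def eta_b triangle_add chi_simps eta_simps power_add power_mult_distrib
      power_mult[symmetric] power_inverse mult_ac field_simps)

end

context hopf_trivial_derivation
begin

text \<open>
  The image of \<open>p\<close> has at \<open>x\<^sup>m z\<^sup>n h\<close> the weighted coefficient of \<open>p\<close> at \<open>g x\<^sup>m y\<^sup>n\<close> with \<open>g c\<^sup>n = h\<close>.
\<close>

definition phi :: "(nat \<Rightarrow> nat \<Rightarrow> 'g \<Rightarrow> 'k) \<Rightarrow> 'g \<Rightarrow> 'k poly poly" where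
  "phi p h = (if h \<in> carrier G then Abs_poly (\<lambda>n. Abs_poly (\<lambda>m.
     weight n m (h \<otimes> inv (c [^] n)) * p n m (h \<otimes> inv (c [^] n)))) else 0)"

lemma cf_phi:
  assumes p: "p \<in> carrier H"
  shows "cf (phi p h) n m = (if h \<in> carrier G
    then weight n m (h \<otimes> inv (c [^] n)) * p n m (h \<otimes> inv (c [^] n)) else 0)"
proof (cases "h \<in> carrier G")
  case True
  let ?f = "\<lambda>n m. weight n m (h \<otimes> inv (c [^] n)) * p n m (h \<otimes> inv (c [^] n))"
  have inner: "finite {m. ?f n m \<noteq> 0}" for n
  proof -
    have "{m. ?f n m \<noteq> 0} \<subseteq> {m. p n m \<noteq> (\<lambda>_. 0)}" by auto
    then show ?thesis using p unfolding H_carrier_iff by (meson finite_subset)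
  qed
  have "{n. Abs_poly (?f n) \<noteq> 0} \<subseteq> {n. p n \<noteq> (\<lambda>_ _. 0)}"
    by (auto simp: zero_poly.abs_eq)
  then have "finite {n. Abs_poly (?f n) \<noteq> 0}"
    using p unfolding H_carrier_iff by (meson finite_subset)
  then show ?thesis using True by (simp add: phi_def coeff_Abs_poly_finite coeff_Abs_poly_finite[OF inner])
next
  case False
  then show ?thesis by (simp add: phi_def)
qed

lemma cf_phi_shift:
  assumes "p \<in> carrier H" "g \<in> carrier G"
  shows "cf (phi p (g \<otimes> c [^] n)) n m = weight n m g * p n m g"
  using assms by (simp add: cf_phi m_assoc)

lemma shift_cancel: "h \<in> carrier G \<Longrightarrow> h \<otimes> inv (c [^] (n::nat)) \<otimes> c [^] n = h"
  by (simp add: m_assoc)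

lemma phi_closed:
  assumes p: "p \<in> carrier H"
  shows "phi p \<in> carrier S"
proof -
  let ?U = "\<Union>n \<in> {n. p n \<noteq> (\<lambda>_ _. 0)}. \<Union>m \<in> {m. p n m \<noteq> (\<lambda>_. 0)}.
    (\<lambda>g. g \<otimes> c [^] n) ` {g. p n m g \<noteq> 0}"
  have "{h. phi p h \<noteq> 0} \<subseteq> ?U"
  proof
    fix h assume "h \<in> {h. phi p h \<noteq> 0}"
    then obtain n m where nz: "cf (phi p h) n m \<noteq> 0"
      using poly_poly_eqI[of "phi p h" 0] by auto
    then have h: "h \<in> carrier G" and "p n m (h \<otimes> inv (c [^] n)) \<noteq> 0"
      by (auto simp: cf_phi[OF p] split: if_splits)
    then have "h \<in> (\<lambda>g. g \<otimes> c [^] n) ` {g. p n m g \<noteq> 0}"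
      by (intro image_eqI[of h _ "h \<otimes> inv (c [^] n)"]) (simp_all add: shift_cancel)
    moreover from this have "p n m \<noteq> (\<lambda>_. 0)" "p n \<noteq> (\<lambda>_ _. 0)" by auto
    ultimately show "h \<in> ?U" by blast
  qed
  moreover have "finite ?U" using p by (auto simp: H_carrier_iff)
  moreover have "{h. phi p h \<noteq> 0} \<subseteq> carrier G" by (auto simp: phi_def)
  ultimately show ?thesis unfolding S_carrier_iff using finite_subset by blast
qed

text \<open>
  Both products are sums over the exponents and the group component of a term of the left factor.
  This component is \<open>a c\<^sup>n\<close> in \<open>K[x, z] # G\<close> where it is \<open>a\<close> in \<open>H\<close>, so that the sum has to be shifted
  separately for each \<open>n\<close>; the factors then agree term by term.
\<close>

lemma phi_mult:
  assumes p: "p \<in> carrier H" and q: "q \<in> carrier H"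
  shows "phi (p \<otimes>\<^bsub>H\<^esub> q) = phi p \<otimes>\<^bsub>S\<^esub> phi q"
proof
  fix h
  interpret S: ring S by (rule S_ring)
  show "phi (p \<otimes>\<^bsub>H\<^esub> q) h = (phi p \<otimes>\<^bsub>S\<^esub> phi q) h"
  proof (cases "h \<in> carrier G")
    case False
    then show ?thesis
      using S_value_out[OF S.m_closed[OF phi_closed[OF p] phi_closed[OF q]], of h]
      by (simp add: phi_def)
  next
    case h: True
    show ?thesis
    proof (rule poly_poly_eqI)
      fix N M :: nat
      \<comment> \<open>\<open>u\<close> is the group component in \<open>H\<close> that belongs to the degree \<open>N\<close> and to \<open>h\<close>.\<close>
      define u where "u = h \<otimes> inv (c [^] N)"
      have u: "u \<in> carrier G" unfolding u_def by (rule m_closed[OF h cpow_in(2)])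
      have fin: "finite {a. phi p a \<noteq> 0}" using phi_closed[OF p] by (simp add: S_carrier_iff)
      let ?t = "\<lambda>n m a. cf (phi p a) n m * (inverse (\<chi> a) ^ (M - m) * inverse (\<eta> a) ^ (N - n)
          * cf (phi q (inv a \<otimes> h)) (N - n) (M - m))"
      have term_eq: "(\<Sum>a | phi p a \<noteq> 0. ?t n m a)
          = (\<Sum>a | p n m a \<noteq> 0. weight N M u * (p n m a * (\<chi> (inv a \<otimes> u) ^ m *
              (\<eta> b ^ ((M - m) * n) * (\<eta> (inv a \<otimes> u) ^ n * q (N - n) (M - m) (inv a \<otimes> u))))))"
        if n: "n \<le> N" and m: "m \<le> M" for n m
      proof -
        have "(\<Sum>a | phi p a \<noteq> 0. ?t n m a) = (\<Sum>a | cf (phi p a) n m \<noteq> 0. ?t n m a)"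
          by (rule sum.mono_neutral_right) (use fin in auto)
        also have "\<dots> = (\<Sum>a | p n m a \<noteq> 0. ?t n m (a \<otimes> c [^] n))"
        proof (rule sum.reindex_bij_witness[where i = "\<lambda>a. a \<otimes> c [^] n" and j = "\<lambda>a. a \<otimes> inv (c [^] n)"])
          fix a assume "a \<in> {a. p n m a \<noteq> 0}"
          then have a: "a \<in> carrier G" "p n m a \<noteq> 0" using H_value_out[OF p] by auto
          then show "a \<otimes> c [^] n \<otimes> inv (c [^] n) = a" by (simp add: m_assoc)
          show "a \<otimes> c [^] n \<in> {a. cf (phi p a) n m \<noteq> 0}"
            using a by (simp add: cf_phi_shift[OF p] weight_nz)
        qed (auto simp: cf_phi[OF p] shift_cancel split: if_splits)
        also have "\<dots> = (\<Sum>a | p n m a \<noteq> 0. weight N M u * (p n m a * (\<chi> (inv a \<otimes> u) ^ m *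
              (\<eta> b ^ ((M - m) * n) * (\<eta> (inv a \<otimes> u) ^ n * q (N - n) (M - m) (inv a \<otimes> u))))))"
        proof (rule sum.cong[OF refl])
          fix a assume "a \<in> {a. p n m a \<noteq> 0}"
          then have a: "a \<in> carrier G" using H_value_out[OF p] by auto
          define v where "v = inv a \<otimes> u"
          have v: "v \<in> carrier G" and av: "a \<otimes> v = u" using a u by (simp_all add: v_def m_assoc[symmetric])
          have "c [^] n \<otimes> (v \<otimes> c [^] (N - n)) = c [^] n \<otimes> v \<otimes> c [^] (N - n)"
            using v by (simp add: m_assoc)
          also have "\<dots> = v \<otimes> c [^] N"
            unfolding cpow_commutes[OF v] using v n by (simp add: m_assoc nat_pow_mult)
          finally have "a \<otimes> c [^] n \<otimes> (v \<otimes> c [^] (N - n)) = a \<otimes> v \<otimes> c [^] N"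
            using a v by (simp add: m_assoc)
          also have "\<dots> = h" unfolding av by (simp add: u_def h shift_cancel)
          finally have "inv (a \<otimes> c [^] n) \<otimes> h = v \<otimes> c [^] (N - n)"
            using a v by (metis inv_solve_left cpow_in(1) m_closed)
          then have q': "cf (phi q (inv (a \<otimes> c [^] n) \<otimes> h)) (N - n) (M - m)
              = weight (N - n) (M - m) v * q (N - n) (M - m) v"
            using v by (simp add: cf_phi_shift[OF q])
          have sc: "weight N M u * (\<chi> v ^ m * (\<eta> b ^ ((M - m) * n) * \<eta> v ^ n))
            = weight n m a * (inverse (\<chi> (a \<otimes> c [^] n)) ^ (M - m) * inverse (\<eta> (a \<otimes> c [^] n)) ^ (N - n)
              * weight (N - n) (M - m) v)"
            using weight_add[OF a v, of n "N - n" m "M - m"] n m av by simp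
          show "?t n m (a \<otimes> c [^] n) = weight N M u * (p n m a * (\<chi> (inv a \<otimes> u) ^ m *
              (\<eta> b ^ ((M - m) * n) * (\<eta> (inv a \<otimes> u) ^ n * q (N - n) (M - m) (inv a \<otimes> u)))))"
            unfolding q' cf_phi_shift[OF p a] v_def[symmetric]
            using arg_cong[OF sc, of "\<lambda>t. t * (p n m a * q (N - n) (M - m) v)"]
            by (simp only: mult_ac)
        qed
        finally show ?thesis .
      qed
      have "cf ((phi p \<otimes>\<^bsub>S\<^esub> phi q) h) N M = (\<Sum>a | phi p a \<noteq> 0. \<Sum>n\<le>N. \<Sum>m\<le>M. ?t n m a)"
        unfolding S_mult_eq[OF phi_closed[OF p] phi_closed[OF q] h]
        by (simp only: coeff_sum cf_mult cf_poly_act)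
      also have "\<dots> = (\<Sum>n\<le>N. \<Sum>m\<le>M. \<Sum>a | phi p a \<noteq> 0. ?t n m a)"
        by (subst sum.swap) (rule sum.cong[OF refl], rule sum.swap)
      also have "\<dots> = weight N M u * (p \<otimes>\<^bsub>H\<^esub> q) N M u"
        unfolding H_mult_coeff[OF p q u] sum_distrib_left by (intro sum.cong refl term_eq) auto
      also have "\<dots> = cf (phi (p \<otimes>\<^bsub>H\<^esub> q) h) N M"
        using h by (simp add: cf_phi[OF H_mult_closed[OF p q]] u_def)
      finally show "cf (phi (p \<otimes>\<^bsub>H\<^esub> q) h) N M = cf ((phi p \<otimes>\<^bsub>S\<^esub> phi q) h) N M" ..
    qed
  qed
qed

lemma phi_add:
  assumes "p \<in> carrier H" "q \<in> carrier H"
  shows "phi (p \<oplus>\<^bsub>H\<^esub> q) = phi p \<oplus>\<^bsub>S\<^esub> phi q"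
  using assms by (intro ext poly_poly_eqI) (simp add: S_ops cf_phi H_closed H_op_values distrib_left)

lemma phi_smult:
  assumes "p \<in> carrier H"
  shows "phi (k \<odot>\<^bsub>H\<^esub> p) = k \<odot>\<^bsub>S\<^esub> phi p"
  using assms by (intro ext poly_poly_eqI) (simp add: S_ops cf_phi H_smult_closed H_op_values)

lemma phi_emb:
  assumes "f \<in> carrier KG"
  shows "phi (H_emb G \<chi> f) = (\<lambda>h. [:[:f h:]:])"
proof (intro ext poly_poly_eqI)
  fix h n m
  have "f h = 0" if "h \<notin> carrier G" using assms that by (auto simp: KG_carrier_iff)
  then show "cf (phi (H_emb G \<chi> f) h) n m = cf [:[:f h:]:] n m"
    by (auto simp: cf_phi[OF H_emb_closed[OF assms]] H_emb_value weight_def coeff_pCons split: nat.splits)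
qed

lemma phi_grp: "g \<in> carrier G \<Longrightarrow> phi (H_grp G \<chi> g) = single g 1"
  unfolding H_grp_def by (subst phi_emb, erule KG_single_closed) (auto simp: single_def one_pCons)

lemma phi_x: "phi (H_x G \<chi>) = single \<one> poly_x"
  by (intro ext poly_poly_eqI)
    (auto simp: cf_phi[OF H_x_closed] H_x_value weight_def chi_simps single_def poly_x_def coeff_pCons
      split: nat.splits)

lemma phi_y: "phi (H_y G \<chi>) = single c [:0, [:inverse (\<eta> c):]:]"
proof (intro ext poly_poly_eqI)
  fix h n m
  have "h \<otimes> inv c = \<one> \<longleftrightarrow> h = c" if "h \<in> carrier G"
    using that by (metis c_in inv_closed inv_inv inv_equality r_inv)
  then show "cf (phi (H_y G \<chi>) h) n m = cf (single c [:0, [:inverse (\<eta> c):]:] h) n m"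
    by (auto simp: cf_phi[OF H_y_closed] H_y_value weight_def eta_simps char_inv[OF eta] single_def coeff_pCons
      split: nat.splits)
qed

lemma phi_inj: "inj_on phi (carrier H)"
proof (rule inj_onI)
  fix p q assume p: "p \<in> carrier H" and q: "q \<in> carrier H" and eq: "phi p = phi q"
  show "p = q"
  proof (intro ext)
    fix n m g
    show "p n m g = q n m g"
      using cf_phi_shift[OF p, of g n m] cf_phi_shift[OF q, of g n m] eq weight_nz[of g n m]
        H_value_out[OF p, of g] H_value_out[OF q, of g]
      by (cases "g \<in> carrier G") auto
  qed
qed

text \<open>
  Dividing by the weights and shifting back by \<open>c\<^sup>n\<close> gives a preimage; what has to be checked is that
  it has finite support in each of the three indices.
\<close>

lemma phi_surj:
  assumes f: "f \<in> carrier S"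
  obtains p where "p \<in> carrier H" "phi p = f"
proof -
  define p where "p n m g = (if g \<in> carrier G then cf (f (g \<otimes> c [^] n)) n m / weight n m g else 0)"
    for n m g
  have fin: "finite {h. f h \<noteq> 0}" using f by (simp add: S_carrier_iff)
  have nz: "g \<in> carrier G" "cf (f (g \<otimes> c [^] n)) n m \<noteq> 0" if "p n m g \<noteq> 0" for n m g
    using that by (auto simp: p_def split: if_splits)
  have nz': "f h \<noteq> 0" "n \<le> Polynomial.degree (f h)"
    "m \<le> Polynomial.degree (Polynomial.coeff (f h) n)" if "cf (f h) n m \<noteq> 0" for h n m
    using that by (auto intro: le_degree)
  have s1: "{g. p n m g \<noteq> 0} \<subseteq> (\<lambda>h. h \<otimes> inv (c [^] n)) ` {h. f h \<noteq> 0}" for n m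
  proof
    fix g assume "g \<in> {g. p n m g \<noteq> 0}"
    then have "g \<in> carrier G" "f (g \<otimes> c [^] n) \<noteq> 0" using nz[of n m g] nz' by auto
    then show "g \<in> (\<lambda>h. h \<otimes> inv (c [^] n)) ` {h. f h \<noteq> 0}"
      by (intro image_eqI[of _ _ "g \<otimes> c [^] n"]) (simp_all add: m_assoc)
  qed
  have s2: "{m. p n m \<noteq> (\<lambda>_. 0)}
      \<subseteq> (\<Union>h\<in>{h. f h \<noteq> 0}. {..Polynomial.degree (Polynomial.coeff (f h) n)})" for n
    using nz nz' by (fastforce simp: fun_eq_iff)
  have s3: "{n. p n \<noteq> (\<lambda>_ _. 0)} \<subseteq> (\<Union>h\<in>{h. f h \<noteq> 0}. {..Polynomial.degree (f h)})"
    using nz nz' by (fastforce simp: fun_eq_iff)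
  have p: "p \<in> carrier H"
    unfolding H_carrier_iff
    using nz(1) fin s1[THEN finite_subset] s2[THEN finite_subset] s3[THEN finite_subset] by simp
  then have "phi p = f"
    using S_value_out[OF f] by (intro ext poly_poly_eqI) (auto simp: cf_phi p_def weight_nz shift_cancel)
  with p show ?thesis by (rule that)
qed

lemma phi_bij: "bij_betw phi (carrier H) (carrier S)"
  unfolding bij_betw_def using phi_inj phi_closed phi_surj by blast

lemma phi_one: "phi \<one>\<^bsub>H\<^esub> = \<one>\<^bsub>S\<^esub>"
  by (simp add: H_one phi_grp S_ops)

lemma phi_zero: "phi \<zero>\<^bsub>H\<^esub> = \<zero>\<^bsub>S\<^esub>"
  by (intro ext poly_poly_eqI) (simp add: cf_phi H_closed H_op_values S_ops)

lemma H_one_closed: "\<one>\<^bsub>H\<^esub> \<in> carrier H"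
  by (simp add: H_one H_grp_closed)

text \<open>
  Associativity of the iterated Ore extension is inherited from the skew group ring.
\<close>

lemma H_ring: "ring H"
  by (rule ring_if_isomorphic[OF S_ring phi_bij])
    (simp_all add: H_closed H_mult_closed phi_add phi_mult phi_zero phi_one H_one_closed)

lemma phi_iso: "phi \<in> alg_iso H S"
  using phi_bij phi_closed
  by (simp add: alg_iso_def alg_hom_def ring_hom_def phi_add phi_mult phi_one phi_smult Pi_iff)

end

section \<open>The element \<open>z\<close>\<close>

context hopf_trivial_derivation
begin

abbreviation z where "z \<equiv> H_z G \<chi> \<eta> b c \<delta>"

lemma H_z_closed: "z \<in> carrier H"
  by (simp add: H_z_def H_mult_closed H_grp_closed H_y_closed)

text \<open>
  The action of \<open>c\<inverse>\<close> on \<open>z\<close> multiplies by \<open>\<eta>(c)\<close>, which cancels the weight of \<open>y\<close>.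
\<close>

lemma phi_z: "phi z = single \<one> poly_z"
proof -
  have "poly_act \<chi> \<eta> (inv c) [:0, [:inverse (\<eta> c):]:] = poly_z"
  proof (rule poly_poly_eqI)
    fix n m
    show "cf (poly_act \<chi> \<eta> (inv c) [:0, [:inverse (\<eta> c):]:]) n m = cf poly_z n m"
      by (auto simp: cf_poly_act poly_z_def char_inv[OF eta] eta_simps coeff_pCons split: nat.splits)
  qed
  then show ?thesis
    by (simp add: H_z_def phi_mult H_grp_closed H_y_closed phi_grp phi_y S_single_mult)
qed

lemma x_z_commute: "H_x G \<chi> \<otimes>\<^bsub>H\<^esub> z = z \<otimes>\<^bsub>H\<^esub> H_x G \<chi>"
  by (rule inj_onD[OF phi_inj])
    (simp_all add: phi_mult H_x_closed H_z_closed H_mult_closed phi_x phi_z S_single_mult PS.act_one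
      mult.commute)

lemma H_generated:
  "generate_ring H (H_emb G \<chi> ` carrier KG \<union> {H_x G \<chi>, z}) = carrier H" (is "generate_ring H ?X = _")
proof
  interpret H: ring H by (rule H_ring)
  have X: "?X \<subseteq> carrier H" using H_emb_closed H_x_closed H_z_closed by auto
  then show "generate_ring H ?X \<subseteq> carrier H" by (rule H.generate_ring_incl)
  have in_H: "u \<in> carrier H" if "u \<in> generate_ring H ?X" for u
    using H.generate_ring_in_carrier[OF X that] .
  have "carrier S \<subseteq> phi ` generate_ring H ?X"
  proof (rule S_generated)
    fix u v assume "u \<in> phi ` generate_ring H ?X" "v \<in> phi ` generate_ring H ?X"
    then obtain u' v' where u': "u' \<in> generate_ring H ?X" "u = phi u'"
      and v': "v' \<in> generate_ring H ?X" "v = phi v'" by blast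
    show "u \<oplus>\<^bsub>S\<^esub> v \<in> phi ` generate_ring H ?X"
      using u' v' in_H phi_add[of u' v'] by (metis generate_ring.eng_add imageI)
    show "u \<otimes>\<^bsub>S\<^esub> v \<in> phi ` generate_ring H ?X"
      using u' v' in_H phi_mult[of u' v'] by (metis generate_ring.eng_mult imageI)
  next
    show "single \<one> poly_x \<in> phi ` generate_ring H ?X"
      unfolding phi_x[symmetric] by (intro imageI generate_ring.incl) simp
    show "single \<one> poly_z \<in> phi ` generate_ring H ?X"
      unfolding phi_z[symmetric] by (intro imageI generate_ring.incl) simp
    fix g k assume g: "g \<in> carrier G"
    have "single g [:[:k:]:] = phi (H_emb G \<chi> (single g k))"
      unfolding phi_emb[OF KG_single_closed[OF g]] by (auto simp: single_def)
    then show "single g [:[:k:]:] \<in> phi ` generate_ring H ?X"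
      using g by (auto intro!: imageI generate_ring.incl KG_single_closed)
  qed
  show "carrier H \<subseteq> generate_ring H ?X"
  proof
    fix p assume p: "p \<in> carrier H"
    then obtain u where u: "u \<in> generate_ring H ?X" "phi p = phi u"
      using phi_closed \<open>carrier S \<subseteq> phi ` generate_ring H ?X\<close> by blast
    then show "p \<in> generate_ring H ?X" using inj_onD[OF phi_inj _ p in_H, of u] by simp
  qed
qed

lemma z_skew_primitive:
  assumes co: "H_coalgebra G \<chi> \<eta> b c \<delta> \<Delta> \<epsilon>"
  shows "skew_primitive H \<Delta> \<epsilon> (H_grp G \<chi> (inv c)) \<one>\<^bsub>H\<^esub> z"
proof -
  interpret H: ring H by (rule H_ring)
  let ?T = "tensor_algebra H H" and ?t = "pure_tensor H H" and ?g = "H_grp G \<chi> (inv c)"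
  have gl: "group_like H \<Delta> \<epsilon> (H_grp G \<chi> g)" if "g \<in> carrier G" for g
    using co that by (simp add: H_coalgebra_def Let_def)
  have g: "?g \<in> carrier H" and cH: "H_grp G \<chi> c \<in> carrier H" by (simp_all add: H_grp_closed)
  have gc: "?g \<otimes>\<^bsub>H\<^esub> H_grp G \<chi> c = \<one>\<^bsub>H\<^esub>"
    by (rule inj_onD[OF phi_inj])
      (simp_all add: g cH phi_mult phi_grp phi_one S_single_mult S_ops PS.act_unit)
  have "\<Delta> z = \<Delta> ?g \<otimes>\<^bsub>?T\<^esub> \<Delta> (H_y G \<chi>)"
    using co g H_y_closed by (simp add: H_coalgebra_def Let_def alg_hom_def ring_hom_def H_z_def)
  also have "\<dots> = ?t ?g ?g \<otimes>\<^bsub>?T\<^esub> (?t (H_y G \<chi>) \<one>\<^bsub>H\<^esub> \<oplus>\<^bsub>?T\<^esub> ?t (H_grp G \<chi> c) (H_y G \<chi>))"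
    using co gl[of "inv c"] by (simp add: H_coalgebra_def Let_def group_like_def)
  also have "\<dots> = ?t z ?g \<oplus>\<^bsub>?T\<^esub> ?t \<one>\<^bsub>H\<^esub> z"
    by (subst pure_tensor_mult_add)
      (simp_all add: H_ring H_smult_closed g cH H_y_closed gc H_z_def)
  finally show ?thesis
    unfolding skew_primitive_def using gl[of "inv c"] gl[of \<one>] H_z_closed by (simp add: H_one)
qed

end

theorem proposition4p1:
  fixes G :: "('g, 'm) monoid_scheme"
    and \<chi> \<eta> :: "'g \<Rightarrow> 'k::{alg_closed_field, field_char_0}"
    and b c :: 'g and \<beta> :: 'k
    and \<delta> :: "(nat \<Rightarrow> 'g \<Rightarrow> 'k) \<Rightarrow> (nat \<Rightarrow> 'g \<Rightarrow> 'k)"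
    and \<Delta> :: "(nat \<Rightarrow> nat \<Rightarrow> 'g \<Rightarrow> 'k) \<Rightarrow>
                ((nat \<Rightarrow> nat \<Rightarrow> 'g \<Rightarrow> 'k) \<times> (nat \<Rightarrow> nat \<Rightarrow> 'g \<Rightarrow> 'k) \<Rightarrow> 'k) set"
    and \<epsilon> :: "(nat \<Rightarrow> nat \<Rightarrow> 'g \<Rightarrow> 'k) \<Rightarrow> 'k"
  assumes "group G"
    and "\<chi> \<in> char_group G" and "\<eta> \<in> char_group G"
    and "b \<in> group_center G" and "c \<in> group_center G"
    and "\<eta> b = inverse (\<chi> c)"
    and "H_derivation G \<chi> \<eta> b c \<beta> \<delta>"
    and "H_coalgebra G \<chi> \<eta> b c \<delta> \<Delta> \<epsilon>"
    and "\<beta> = 0 \<or> c = inv\<^bsub>G\<^esub> b"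
  shows "let H = H_alg G \<chi> \<eta> b \<delta>; x = H_x G \<chi>; z = H_z G \<chi> \<eta> b c \<delta>;
             S = poly_skew_group_ring G \<chi> \<eta> in
           generate_ring H (H_emb G \<chi> ` carrier (monoid_algebra G) \<union> {x, z}) = carrier H \<and>
           x \<otimes>\<^bsub>H\<^esub> z = z \<otimes>\<^bsub>H\<^esub> x \<and>
           skew_primitive H \<Delta> \<epsilon> (H_grp G \<chi> (inv\<^bsub>G\<^esub> c)) \<one>\<^bsub>H\<^esub> z \<and>
           (\<exists>\<phi> \<in> alg_iso H S.
              \<phi> x = single \<one>\<^bsub>G\<^esub> poly_x \<and> \<phi> z = single \<one>\<^bsub>G\<^esub> poly_z \<and>
              (\<forall>g \<in> carrier G. \<phi> (H_grp G \<chi> g) = single g 1))"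
proof -
  interpret hopf_data G \<chi> \<eta> b c
    by (intro hopf_data.intro hopf_data_axioms.intro assms)
  interpret hopf_trivial_derivation G \<chi> \<eta> b c \<delta>
    by unfold_locales (rule derivation_trivial[OF assms(7,9)])
  show ?thesis
    unfolding Let_def
    using H_generated x_z_commute z_skew_primitive[OF assms(8)] phi_iso phi_x phi_z phi_grp by blast
qed

end
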